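(* Let $K$ be a field and let $(L,\rho)$ be a partial character on $\mathbb{Z}^m$, with $L$ a non-zero positive sublattice of $\mathbb{Z}^m$, such that the configuration of vectors $A=\{\mathbf{a}_1,\ldots,\mathbf{a}_m\}$ associated to the lattice $L$ is full. Then: (1) if $K$ has characteristic zero, $I_{L,\rho}$ is either a set-theoretic complete intersection or an almost set-theoretic complete intersection; (2) if $K$ has positive characteristic, $I_{L,\rho}$ is a set-theoretic complete intersection.
   Context: A partial character $(L,\rho)$ on $\mathbb{Z}^m$ is a homomorphism $\rho$ from a sublattice (subgroup) $L$ of $\mathbb{Z}^m$ to the multiplicative group $K^*=K\setminus\{0\}$. The lattice $L$ is positive if $L\cap\mathbb{N}^m=\{\mathbf{0}\}$. Every $\mathbf{u}\in\mathbb{Z}^m$ is written uniquely as $\mathbf{u}=\mathbf{u}_+-\mathbf{u}_-$ with $\mathbf{u}_+,\mathbf{u}_-$ non-negative with disjoint supports. For $\mathbf{u}\in L$ put $B(\mathbf{u}):=\mathbf{x}^{\mathbf{u}_+}-\rho(\mathbf{u})\mathbf{x}^{\mathbf{u}_-}\in K[x_1,\ldots,x_m]$. The lattice ideal $I_{L,\rho}$ is the ideal generated by all $B(\mathbf{u})$, $\mathbf{u}\in L$. The saturation of $L$ is $Sat(L)=\{\alpha\in\mathbb{Z}^m : d\alpha\in L \text{ for some } d\in\mathbb{Z}, d\neq 0\}$. Let $n=m-rank(L)$, fix an isomorphism $\psi:\mathbb{Z}^m/Sat(L)\to\mathbb{Z}^n$, and put $\mathbf{a}_i=\psi(\mathbf{e}_i+Sat(L))$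 for $1\le i\le m$, where $\mathbf{e}_1,\dots,\mathbf{e}_m$ are the unit vectors of $\mathbb{Z}^m$. The configuration of vectors associated to $L$ is $A=\{\mathbf{a}_1,\ldots,\mathbf{a}_m\}\subset\mathbb{Z}^n$ (indexed by $1,\dots,m$). For vectors $\mathbf{b}_1,\dots,\mathbf{b}_k\in\mathbb{Q}^n$, $pos_{\mathbb{Q}}(\mathbf{b}_1,\dots,\mathbf{b}_k)=\{\sum\lambda_i\mathbf{b}_i:\lambda_i\in\mathbb{Q},\lambda_i\ge 0\}$. A face of a cone $\sigma$ is a set $\sigma\cap\{\mathbf{x}:\mathbf{c}\mathbf{x}=0\}$ with $\mathbf{c}\in\mathbb{Q}^n$ and $\mathbf{c}\mathbf{x}\ge0$ on $\sigma$. The one-dimensional faces are the extreme rays; a cone is a simplex cone if the number of its extreme rays equals its dimension (i.e. the extreme rays are linearly independent). The configuration $A=\{\mathbf{a}_1,\ldots,\mathbf{a}_m\}$ is full if (1) the cone $\sigma=pos_{\mathbb{Q}}(A)$ is an $n$-dimensional simplex cone generated by $\mathbf{a}_1,\ldots,\mathbf{a}_n$, i.e. $\sigma=pos_{\mathbb{Q}}(\mathbf{a}_1,\ldots,\mathbf{a}_n)$; and (2) for each $n<i\le m$ the minimal face of $\sigma$ containing $\mathbf{a}_i$ is $\sigma$ itself, i.e. $\mathbf{a}_i$ is a strictly positive rational linear combination of $\mathbf{a}_1,\ldots,\mathbf{a}_n$. The arithmetical rank ${\rm ara}(I)$ of an ideal $I\subset K[x_1,\dots,x_m]$ is the smallest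 integer $s$ for which there exist $f_1,\ldots,f_s\in I$ with $rad(I)=rad(f_1,\ldots,f_s)$; $h(I)$ denotes the height of $I$. The ideal $I$ is a set-theoretic complete intersection if ${\rm ara}(I)=h(I)$, and an almost set-theoretic complete intersection if ${\rm ara}(I)\le h(I)+1$. *)

theory Defs
  imports
    "HOL-Analysis.Analysis"
    "HOL-Algebra.Coset"
    "HOL-Library.Poly_Mapping"
    "HOL-Library.Extended_Nat"
begin

section \<open>Ideals of a commutative ring\<close>

text \<open>A commutative ring is a module over itself; its submodules are its ideals.\<close>

definition is_ideal :: "'a::comm_ring_1 set \<Rightarrow> bool"
  where "is_ideal = module.subspace (*)"

definition ideal_of :: "'a::comm_ring_1 set \<Rightarrow> 'a set"
  where "ideal_of = module.span (*)"

definition ideal_radical :: "'a::comm_ring_1 set \<Rightarrow> 'a set"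
  where "ideal_radical I = {f. \<exists>k>0. f ^ k \<in> I}"

definition prime_ideal :: "'a::comm_ring_1 set \<Rightarrow> bool"
  where "prime_ideal P \<longleftrightarrow>
    is_ideal P \<and> P \<noteq> UNIV \<and> (\<forall>a b. a * b \<in> P \<longrightarrow> a \<in> P \<or> b \<in> P)"

definition prime_height :: "'a::comm_ring_1 set \<Rightarrow> enat"
  where "prime_height P = Sup {enat k | k.
    \<exists>C. (\<forall>i\<le>k. prime_ideal (C i)) \<and> (\<forall>i<k. C i \<subset> C (Suc i)) \<and> C k = P}"

definition ideal_height :: "'a::comm_ring_1 set \<Rightarrow> enat"
  where "ideal_height I = Inf {prime_height P | P. prime_ideal P \<and> I \<subseteq> P}"

text \<open>The infimum over \<^typ>\<open>enat\<close> is attained whenever a suitable list exists, and is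
  \<open>\<infinity>\<close> otherwise (which cannot happen for ideals of a Noetherian ring).\<close>

definition ara :: "'a::comm_ring_1 set \<Rightarrow> enat"
  where "ara I = Inf {enat s | s.
    \<exists>fs. length fs = s \<and> set fs \<subseteq> I \<and> ideal_radical I = ideal_radical (ideal_of (set fs))}"

definition set_theoretic_ci :: "'a::comm_ring_1 set \<Rightarrow> bool"
  where "set_theoretic_ci I \<longleftrightarrow> ara I = ideal_height I"

definition almost_set_theoretic_ci :: "'a::comm_ring_1 set \<Rightarrow> bool"
  where "almost_set_theoretic_ci I \<longleftrightarrow> ara I \<le> ideal_height I + 1"


section \<open>Lattices, partial characters and lattice ideals\<close>

text \<open>A finite linearly ordered index type \<open>'m\<close> plays the role of \<open>{1, \<dots>, m}\<close>, so that
  \<open>\<int>\<^sup>m\<close> is \<open>int ^ 'm\<close> and \<open>K[x\<^sub>1, \<dots>, x\<^sub>m]\<close> is the following type.\<close>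

type_synonym ('m, 'k) mpoly = "('m \<Rightarrow>\<^sub>0 nat) \<Rightarrow>\<^sub>0 'k"

definition additive_group :: "'a::ab_group_add monoid"
  where "additive_group = \<lparr>carrier = UNIV, monoid.mult = (+), one = 0\<rparr>"

definition unit_group :: "'k::field monoid"
  where "unit_group = \<lparr>carrier = UNIV - {0}, monoid.mult = (*), one = 1\<rparr>"

text \<open>The values of \<open>\<rho>\<close> outside of \<open>L\<close> are irrelevant.\<close>

definition partial_character :: "(int ^ 'm) set \<Rightarrow> (int ^ 'm \<Rightarrow> 'k::field) \<Rightarrow> bool"
  where "partial_character L \<rho> \<longleftrightarrow>
    subgroup L additive_group \<and> \<rho> \<in> hom (additive_group\<lparr>carrier := L\<rparr>) unit_group"

definition positive_lattice :: "(int ^ 'm) set \<Rightarrow> bool"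
  where "positive_lattice L \<longleftrightarrow> L \<inter> {u. \<forall>i. 0 \<le> u $ i} = {0}"

definition pos_part :: "int ^ 'm::finite \<Rightarrow> ('m \<Rightarrow>\<^sub>0 nat)"
  where "pos_part u = (\<Sum>i\<in>UNIV. Poly_Mapping.single i (nat (u $ i)))"

definition neg_part :: "int ^ 'm::finite \<Rightarrow> ('m \<Rightarrow>\<^sub>0 nat)"
  where "neg_part u = (\<Sum>i\<in>UNIV. Poly_Mapping.single i (nat (- (u $ i))))"

definition lattice_binomial ::
    "(int ^ 'm::finite \<Rightarrow> 'k::field) \<Rightarrow> int ^ 'm \<Rightarrow> ('m, 'k) mpoly"
  where "lattice_binomial \<rho> u =
    Poly_Mapping.single (pos_part u) 1 - Poly_Mapping.single (neg_part u) (\<rho> u)"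

definition lattice_ideal ::
    "(int ^ 'm::finite) set \<Rightarrow> (int ^ 'm \<Rightarrow> 'k::field) \<Rightarrow> ('m, 'k) mpoly set"
  where "lattice_ideal L \<rho> = ideal_of (lattice_binomial \<rho> ` L)"

definition saturation :: "(int ^ 'm) set \<Rightarrow> (int ^ 'm) set"
  where "saturation L = {\<alpha>. \<exists>d. d \<noteq> 0 \<and> d *s \<alpha> \<in> L}"

definition rat_vec :: "int ^ 'n \<Rightarrow> rat ^ 'n"
  where "rat_vec v = (\<chi> i. of_int (v $ i))"

text \<open>The rank of a lattice is the dimension of the rational vector space it spans.\<close>

definition lattice_rank :: "(int ^ 'm::finite) set \<Rightarrow> nat"
  where "lattice_rank L = vec.dim (rat_vec ` L)"

text \<open>The vectors \<open>\<a>\<^sub>i = \<psi>(\<e>\<^sub>i + Sat(L))\<close>. The elements of the quotient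
  \<open>additive_group Mod saturation L\<close> are the cosets of \<open>saturation L\<close>.\<close>

definition associated_configuration ::
    "(int ^ 'm::finite) set \<Rightarrow> ((int ^ 'm) set \<Rightarrow> int ^ 'n) \<Rightarrow> 'm \<Rightarrow> int ^ 'n"
  where "associated_configuration L \<psi> i = \<psi> (saturation L #>\<^bsub>additive_group\<^esub> axis i 1)"


section \<open>Rational cones and full configurations\<close>

definition pos_cone :: "'i set \<Rightarrow> ('i \<Rightarrow> rat ^ 'n) \<Rightarrow> (rat ^ 'n) set"
  where "pos_cone J b = {\<Sum>i\<in>J. c i *s b i | c. \<forall>i\<in>J. 0 \<le> c i}"

definition rat_dot :: "rat ^ 'n::finite \<Rightarrow> rat ^ 'n \<Rightarrow> rat"
  where "rat_dot c x = (\<Sum>i\<in>UNIV. c $ i * x $ i)"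

definition cone_face :: "(rat ^ 'n::finite) set \<Rightarrow> (rat ^ 'n) set \<Rightarrow> bool"
  where "cone_face \<sigma> F \<longleftrightarrow>
    (\<exists>c. (\<forall>x\<in>\<sigma>. 0 \<le> rat_dot c x) \<and> F = \<sigma> \<inter> {x. rat_dot c x = 0})"

text \<open>The dimension of a cone is that of its linear span, i.e. \<^term>\<open>vec.dim \<sigma>\<close>.\<close>

definition extreme_rays :: "(rat ^ 'n::finite) set \<Rightarrow> (rat ^ 'n) set set"
  where "extreme_rays \<sigma> = {F. cone_face \<sigma> F \<and> vec.dim F = 1}"

definition simplex_cone :: "(rat ^ 'n::finite) set \<Rightarrow> bool"
  where "simplex_cone \<sigma> \<longleftrightarrow>
    finite (extreme_rays \<sigma>) \<and> card (extreme_rays \<sigma>) = vec.dim \<sigma>"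

definition minimal_face :: "(rat ^ 'n::finite) set \<Rightarrow> rat ^ 'n \<Rightarrow> (rat ^ 'n) set"
  where "minimal_face \<sigma> v = \<Inter> {F. cone_face \<sigma> F \<and> v \<in> F}"

text \<open>The \<open>k\<close> smallest indices.\<close>

definition first_indices :: "nat \<Rightarrow> 'm::{finite, linorder} set"
  where "first_indices k = {i. card {j. j < i} < k}"

definition full_configuration :: "('m::{finite, linorder} \<Rightarrow> int ^ 'n::finite) \<Rightarrow> bool"
  where "full_configuration a \<longleftrightarrow>
    (let b = (\<lambda>i. rat_vec (a i));
         \<sigma> = pos_cone UNIV b;
         J = first_indices CARD('n)
     in vec.dim \<sigma> = CARD('n) \<and> simplex_cone \<sigma> \<and> \<sigma> = pos_cone J b \<and>
        (\<forall>i. i \<notin> J \<longrightarrow> minimal_face \<sigma> (b i) = \<sigma>))"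

end

theory Submission
  imports Defs "HOL-Computational_Algebra.Primes"
begin

text \<open>Let \<open>J\<close> be the indices of the generators of the simplex cone and \<open>r = m - n\<close> the rank of \<open>L\<close>.
  Fullness says that \<open>L\<close> has no nonzero vector supported in \<open>J\<close>, and for each \<open>s \<notin> J\<close> contains
  \<open>w\<^sub>s\<close> with a positive entry at \<open>s\<close>, negative entries on \<open>J\<close> and zeros elsewhere.

  Upper bounds for the arithmetical rank: adding the \<open>r\<close> indices outside of \<open>J\<close> one at a time, take
  \<open>q u + l\<close>, where \<open>u\<close> generates the next section of \<open>L\<close> modulo the previous one and \<open>l\<close> is a
  combination of the \<open>w\<^sub>s\<close> already treated. If \<open>q\<close> is large, \<open>l\<close> can be chosen so that the
  new index carries the only positive entry and all entries on \<open>J\<close> are negative. The \<open>r\<close>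
  resulting binomials have the correct zeros outside of the torus, and inside of the torus they
  define the sublattice \<open>L'\<close> spanned by their exponents. In characteristic \<open>p\<close> let the multipliers \<open>q\<close>
  be powers of \<open>p\<close>; then \<open>p\<^sup>e L \<subseteq> L'\<close> and Frobenius shows that \<open>L'\<close> and \<open>L\<close> have the same
  zeros. In general let the multipliers be pairwise coprime; then \<open>L / L'\<close> is cyclic, and one
  more binomial suffices. Points are replaced by prime ideals throughout.

  Lower bound for the arithmetical rank: together with the variables in \<open>J\<close>, polynomials with the
  radical of \<open>I\<^sub>L\<close> define the origin of affine \<open>m\<close>-space; comparing the growth of Hilbert functions,
  there are at least \<open>m\<close> of them.

  Height: below a prime \<open>P\<close> containing \<open>I\<^sub>L\<close>, the extensions of the contractions of \<open>P\<close> to the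
  polynomial rings in the first \<open>k\<close> variables contain a chain of length \<open>r\<close>. Conversely the
  variables in \<open>J\<close> are algebraically independent modulo some prime containing \<open>I\<^sub>L\<close>, and each step of
  a chain of primes raises the growth of the Hilbert function of the residue ring by one.\<close>

section \<open>Ideals, radicals and chains of primes\<close>

lemma module_times: "module ((*) :: 'a::comm_ring_1 \<Rightarrow> 'a \<Rightarrow> 'a)"
  by standard (auto simp: algebra_simps)

lemma is_ideal_iff:
  "is_ideal I \<longleftrightarrow> 0 \<in> I \<and> (\<forall>x\<in>I. \<forall>y\<in>I. x + y \<in> I) \<and> (\<forall>c. \<forall>x\<in>I. c * x \<in> I)"
  by (simp add: is_ideal_def module.subspace_def[OF module_times])

lemma is_idealD:
  assumes "is_ideal I"
  shows ideal_zero: "0 \<in> I"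
    and ideal_add: "x \<in> I \<Longrightarrow> y \<in> I \<Longrightarrow> x + y \<in> I"
    and ideal_mult_left: "x \<in> I \<Longrightarrow> c * x \<in> I"
    and ideal_mult_right: "x \<in> I \<Longrightarrow> x * c \<in> I"
  using assms by (auto simp: is_ideal_iff mult.commute)

lemma ideal_uminus: "is_ideal I \<Longrightarrow> x \<in> I \<Longrightarrow> - x \<in> I"
  by (metis ideal_mult_left mult_minus1)

lemma ideal_diff: "is_ideal I \<Longrightarrow> x \<in> I \<Longrightarrow> y \<in> I \<Longrightarrow> x - y \<in> I"
  by (metis ideal_add ideal_uminus uminus_add_conv_diff add.commute)

lemma ideal_add_iff: "is_ideal I \<Longrightarrow> x \<in> I \<Longrightarrow> x + y \<in> I \<longleftrightarrow> y \<in> I"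
  by (metis ideal_add ideal_diff add_diff_cancel_left')

lemma ideal_diff_iff:
  assumes "is_ideal I" "x - y \<in> I"
  shows "x \<in> I \<longleftrightarrow> y \<in> I"
  by (metis assms ideal_add_iff diff_add_cancel)

lemma ideal_sum: "is_ideal I \<Longrightarrow> (\<And>i. i \<in> A \<Longrightarrow> f i \<in> I) \<Longrightarrow> sum f A \<in> I"
  by (induction A rule: infinite_finite_induct) (auto simp: ideal_zero ideal_add)

lemma is_ideal_ideal_of: "is_ideal (ideal_of S)"
  by (simp add: is_ideal_def ideal_of_def module.subspace_span[OF module_times])

lemma ideal_of_superset: "S \<subseteq> ideal_of S"
  by (simp add: ideal_of_def module.span_superset[OF module_times])

lemma ideal_of_subset_iff:
  assumes "is_ideal I"
  shows "ideal_of S \<subseteq> I \<longleftrightarrow> S \<subseteq> I"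
  using assms ideal_of_superset
  by (auto simp: ideal_of_def is_ideal_def dest: module.span_minimal[OF module_times])

text \<open>Coefficients are indexed by positions of the list, so that the number of summands is the
  length that \<open>ara\<close> counts, also when entries repeat.\<close>

lemma ideal_of_list_sum:
  assumes "x \<in> ideal_of (set gs)"
  shows "\<exists>q. x = (\<Sum>i<length gs. q i * gs ! i)"
proof -
  let ?I = "{x. \<exists>q. x = (\<Sum>i<length gs. q i * gs ! i)}"
  have "is_ideal ?I"
    unfolding is_ideal_iff
  proof (intro conjI ballI allI)
    show "0 \<in> ?I" by (auto intro!: exI[of _ "\<lambda>_. 0"])
    fix x assume "x \<in> ?I"
    then obtain q where q: "x = (\<Sum>i<length gs. q i * gs ! i)" by blast
    show "c * x \<in> ?I" for c
      by (auto simp: q sum_distrib_left mult.assoc intro!: exI[of _ "\<lambda>i. c * q i"])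
    fix y assume "y \<in> ?I"
    then obtain p where "y = (\<Sum>i<length gs. p i * gs ! i)" by blast
    then show "x + y \<in> ?I"
      by (auto simp: q sum.distrib distrib_right intro!: exI[of _ "\<lambda>i. q i + p i"])
  qed
  moreover have "set gs \<subseteq> ?I"
  proof
    fix g assume "g \<in> set gs"
    then obtain j where j: "j < length gs" "gs ! j = g" by (auto simp: in_set_conv_nth)
    have "(\<Sum>i<length gs. of_bool (i = j) * gs ! i) = (\<Sum>i\<in>{j}. gs ! i)"
      using j by (intro sum.mono_neutral_cong_right) auto
    then show "g \<in> ?I" using j by (auto intro!: exI[of _ "\<lambda>i. of_bool (i = j)"])
  qed
  ultimately show ?thesis using assms ideal_of_subset_iff by blast
qed

lemma prime_idealD:
  assumes "prime_ideal P"
  shows prime_ideal_is_ideal: "is_ideal P"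
    and prime_ideal_one: "1 \<notin> P"
    and prime_ideal_mult: "a * b \<in> P \<longleftrightarrow> a \<in> P \<or> b \<in> P"
proof -
  show I: "is_ideal P" using assms by (simp add: prime_ideal_def)
  show "1 \<notin> P" using assms ideal_mult_left[OF I, of 1]
    unfolding prime_ideal_def by (metis UNIV_eq_I mult.right_neutral)
  show "a * b \<in> P \<longleftrightarrow> a \<in> P \<or> b \<in> P"
    using assms ideal_mult_left[OF I] ideal_mult_right[OF I] by (auto simp: prime_ideal_def)
qed

lemma prime_ideal_power: "prime_ideal P \<Longrightarrow> 0 < n \<Longrightarrow> x ^ n \<in> P \<longleftrightarrow> x \<in> P"
proof (induction n)
  case (Suc n)
  then show ?case by (cases n) (auto simp: prime_ideal_mult)
qed auto

lemma prime_ideal_prod: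
  "finite A \<Longrightarrow> prime_ideal P \<Longrightarrow> prod f A \<in> P \<longleftrightarrow> (\<exists>i\<in>A. f i \<in> P)"
  by (induction A rule: finite_induct) (auto simp: prime_ideal_mult prime_ideal_one)

lemma is_ideal_Union_chain:
  assumes "C \<noteq> {}" "subset.chain {I. is_ideal I \<and> Q I} C"
  shows "is_ideal (\<Union>C)"
  unfolding is_ideal_iff
proof (intro conjI ballI allI)
  have id: "is_ideal I" if "I \<in> C" for I using that assms(2) by (auto simp: subset.chain_def)
  show "0 \<in> \<Union>C" using assms(1) id ideal_zero by blast
  show "c * x \<in> \<Union>C" if "x \<in> \<Union>C" for c x using that id ideal_mult_left by blast
  show "x + y \<in> \<Union>C" if xy: "x \<in> \<Union>C" "y \<in> \<Union>C" for x y
  proof -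
    obtain I I' where I: "I \<in> C" "I' \<in> C" "x \<in> I" "y \<in> I'" using xy by blast
    then consider "I \<subseteq> I'" | "I' \<subseteq> I" using assms(2) by (auto simp: subset_chain_def)
    then show ?thesis using I id ideal_add by cases blast+
  qed
qed

text \<open>Krull's argument: by Zorn some ideal is maximal among those that contain
  \<open>I\<close> and miss \<open>M\<close>. Adjoining any further element makes it meet
  \<open>M\<close>; multiplying two such elements of \<open>M\<close> shows that the complement is
  closed under products.\<close>

lemma prime_ideal_avoiding:
  assumes I: "is_ideal I" and M1: "1 \<in> M" and M: "\<And>a b. a \<in> M \<Longrightarrow> b \<in> M \<Longrightarrow> a * b \<in> M"
    and IM: "I \<inter> M = {}"
  obtains P where "prime_ideal P" "I \<subseteq> P" "P \<inter> M = {}"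
proof -
  let ?\<A> = "{P. is_ideal P \<and> (I \<subseteq> P \<and> P \<inter> M = {})}"
  have "\<exists>P\<in>?\<A>. \<forall>X\<in>?\<A>. P \<subseteq> X \<longrightarrow> X = P"
  proof (rule subset_Zorn_nonempty)
    show "?\<A> \<noteq> {}" using I IM by blast
    fix C assume "C \<noteq> {}" and C: "subset.chain ?\<A> C"
    then have "is_ideal (\<Union>C)" by (rule is_ideal_Union_chain)
    moreover have "I \<subseteq> \<Union>C" "\<Union>C \<inter> M = {}"
      using \<open>C \<noteq> {}\<close> C unfolding subset_chain_def by blast+
    ultimately show "\<Union>C \<in> ?\<A>" by blast
  qed
  then obtain P where P': "P \<in> ?\<A>" and max': "\<forall>X\<in>?\<A>. P \<subseteq> X \<longrightarrow> X = P" by (elim bexE)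
  from P' have P: "is_ideal P" "I \<subseteq> P" "P \<inter> M = {}" by simp_all
  have max: "X = P" if "is_ideal X" "X \<inter> M = {}" "P \<subseteq> X" for X
  proof -
    have "X \<in> ?\<A>" using that P(2) by auto
    then show ?thesis using max' that(3) by (elim ballE[of _ _ X]) simp_all
  qed
  have meets: "\<exists>p\<in>P. \<exists>c. p + c * a \<in> M" if "a \<notin> P" for a
  proof (rule ccontr)
    assume none: "\<not> (\<exists>p\<in>P. \<exists>c. p + c * a \<in> M)"
    let ?X = "{p + c * a | p c. p \<in> P}"
    have "is_ideal ?X"
      unfolding is_ideal_iff
    proof (intro conjI ballI allI)
      show "0 \<in> ?X" using ideal_zero[OF P(1)] by (auto intro!: exI[of _ 0])
      fix x assume "x \<in> ?X"
      then obtain p c where x: "x = p + c * a" "p \<in> P" by blast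
      have "d * x = d * p + (d * c) * a" for d by (simp add: x algebra_simps)
      then show "d * x \<in> ?X" for d using ideal_mult_left[OF P(1) x(2)] by blast
      fix y assume "y \<in> ?X"
      then obtain p' c' where y: "y = p' + c' * a" "p' \<in> P" by blast
      have "x + y = (p + p') + (c + c') * a" by (simp add: x y algebra_simps)
      then show "x + y \<in> ?X" using ideal_add[OF P(1) x(2) y(2)] by blast
    qed
    moreover have "?X \<inter> M = {}" using none by blast
    moreover have "P \<subseteq> ?X" by (force intro: exI[of _ 0])
    ultimately have "?X = P" by (rule max)
    moreover have "0 + 1 * a \<in> ?X" using ideal_zero[OF P(1)] by blast
    ultimately show False using that by simp
  qed
  have "prime_ideal P"
    unfolding prime_ideal_def
  proof (intro conjI allI impI P)
    show "P \<noteq> UNIV" using P M1 by blast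
    fix a b assume ab: "a * b \<in> P"
    show "a \<in> P \<or> b \<in> P"
    proof (rule ccontr)
      assume "\<not> (a \<in> P \<or> b \<in> P)"
      then obtain p c q d where pq: "p \<in> P" "q \<in> P" "p + c * a \<in> M" "q + d * b \<in> M"
        using meets by meson
      have "(p + c * a) * (q + d * b) = p * (q + d * b) + q * (c * a) + c * d * (a * b)"
        by (simp add: algebra_simps)
      also have "\<dots> \<in> P" using pq ab P(1)
        by (meson ideal_add ideal_mult_right ideal_mult_left)
      finally show False using M[OF pq(3,4)] P(3) by blast
    qed
  qed
  then show thesis using P that by blast
qed

text \<open>Prime ideals replace the points of a variety here. For the harder direction a prime that
  avoids all powers of \<open>f\<close> is chosen.\<close>

lemma ideal_radical_iff_primes:
  assumes "is_ideal I"
  shows "f \<in> ideal_radical I \<longleftrightarrow> (\<forall>P. prime_ideal P \<and> I \<subseteq> P \<longrightarrow> f \<in> P)"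
proof
  assume "f \<in> ideal_radical I"
  then show "\<forall>P. prime_ideal P \<and> I \<subseteq> P \<longrightarrow> f \<in> P"
    by (auto simp: ideal_radical_def prime_ideal_power)
next
  assume primes: "\<forall>P. prime_ideal P \<and> I \<subseteq> P \<longrightarrow> f \<in> P"
  show "f \<in> ideal_radical I"
  proof (rule ccontr)
    assume f: "f \<notin> ideal_radical I"
    have "I \<inter> range (\<lambda>n. f ^ n) = {}"
    proof (rule ccontr)
      assume "I \<inter> range (\<lambda>n. f ^ n) \<noteq> {}"
      then obtain n where "f ^ n \<in> I" by blast
      \<comment> \<open>The radical asks for a positive exponent, while \<open>n\<close> may be
        0.\<close>
      then have "f ^ Suc n \<in> I" using assms by (simp add: ideal_mult_left)
      then show False using f by (auto simp: ideal_radical_def)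
    qed
    then obtain P where "prime_ideal P" "I \<subseteq> P" "P \<inter> range (\<lambda>n. f ^ n) = {}"
      using prime_ideal_avoiding[OF assms, of "range (\<lambda>n. f ^ n)"]
      by (metis (no_types, lifting) power_0 power_add rangeE rangeI)
    then show False using primes by (metis disjoint_iff power_one_right rangeI)
  qed
qed

text \<open>Radicals are intersections of primes, so it suffices to compare which primes contain the
  two sets of generators.\<close>

lemma ideal_radical_ideal_of_eq:
  assumes "S \<subseteq> ideal_of T"
    and "\<And>P. prime_ideal P \<Longrightarrow> S \<subseteq> P \<Longrightarrow> T \<subseteq> P"
  shows "ideal_radical (ideal_of T) = ideal_radical (ideal_of S)"
proof -
  have "ideal_of T \<subseteq> P \<longleftrightarrow> ideal_of S \<subseteq> P" if "prime_ideal P" for P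
  proof
    show "ideal_of S \<subseteq> P" if "ideal_of T \<subseteq> P"
      using assms(1) that \<open>prime_ideal P\<close>
      by (simp add: ideal_of_subset_iff prime_ideal_is_ideal subset_trans)
    show "ideal_of T \<subseteq> P" if "ideal_of S \<subseteq> P"
      using assms(2) that \<open>prime_ideal P\<close> by (simp add: ideal_of_subset_iff prime_ideal_is_ideal)
  qed
  then show ?thesis by (auto simp: ideal_radical_iff_primes is_ideal_ideal_of)
qed

lemma ara_le:
  assumes "length fs = s" "set fs \<subseteq> I" "ideal_radical I = ideal_radical (ideal_of (set fs))"
  shows "ara I \<le> enat s"
  unfolding ara_def using assms by (intro Inf_lower) blast

lemma le_ara:
  assumes "\<And>fs. set fs \<subseteq> I \<Longrightarrow> ideal_radical I = ideal_radical (ideal_of (set fs)) \<Longrightarrow> s \<le> length fs"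
  shows "enat s \<le> ara I"
  unfolding ara_def using assms by (intro Inf_greatest) auto

section \<open>Chains of primes and the height\<close>

definition prime_chain :: "nat \<Rightarrow> 'a::comm_ring_1 set \<Rightarrow> bool"
  where "prime_chain k P \<longleftrightarrow>
    (\<exists>C. (\<forall>i\<le>k. prime_ideal (C i)) \<and> (\<forall>i<k. C i \<subset> C (Suc i)) \<and> C k = P)"

lemma prime_height_eq: "prime_height P = Sup {enat k | k. prime_chain k P}"
  by (simp add: prime_height_def prime_chain_def)

lemma prime_chain_0: "prime_chain 0 P \<longleftrightarrow> prime_ideal P"
proof
  show "prime_chain 0 P" if "prime_ideal P"
    unfolding prime_chain_def using that by (intro exI[of _ "\<lambda>_. P"]) simp
qed (auto simp: prime_chain_def)

lemma prime_chain_prime: "prime_chain k P \<Longrightarrow> prime_ideal P"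
  by (auto simp: prime_chain_def)

lemma prime_chain_Suc:
  "prime_chain (Suc k) P \<longleftrightarrow> prime_ideal P \<and> (\<exists>P'. P' \<subset> P \<and> prime_chain k P')"
proof
  assume "prime_chain (Suc k) P"
  then obtain C where C: "\<forall>i\<le>Suc k. prime_ideal (C i)" "\<forall>i<Suc k. C i \<subset> C (Suc i)" "C (Suc k) = P"
    unfolding prime_chain_def by blast
  then have "prime_chain k (C k)" unfolding prime_chain_def by (intro exI[of _ C]) auto
  moreover have "prime_ideal P" "C k \<subset> P" using C by auto
  ultimately show "prime_ideal P \<and> (\<exists>P'. P' \<subset> P \<and> prime_chain k P')" by blast
next
  assume "prime_ideal P \<and> (\<exists>P'. P' \<subset> P \<and> prime_chain k P')"
  then obtain C where P: "prime_ideal P" "C k \<subset> P"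
    and C: "\<forall>i\<le>k. prime_ideal (C i)" "\<forall>i<k. C i \<subset> C (Suc i)"
    unfolding prime_chain_def by blast
  let ?C = "\<lambda>i. if i \<le> k then C i else P"
  have "\<forall>i<Suc k. ?C i \<subset> ?C (Suc i)"
    using P C by (auto simp: less_Suc_eq_le Suc_le_eq order_le_less)
  then show "prime_chain (Suc k) P"
    unfolding prime_chain_def using P C by (intro exI[of _ ?C]) auto
qed

text \<open>The smallest primes are dropped, so that the top of the chain stays
  \<open>P\<close>.\<close>

lemma prime_chain_mono: "prime_chain k P \<Longrightarrow> l \<le> k \<Longrightarrow> prime_chain l P"
proof (induction k arbitrary: l P)
  case (Suc k)
  show ?case
  proof (cases l)
    case 0
    then show ?thesis using Suc.prems prime_chain_prime prime_chain_0 by blast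
  next
    case (Suc l')
    then show ?thesis using Suc.prems Suc.IH unfolding Suc prime_chain_Suc by blast
  qed
qed auto

lemma le_ideal_height:
  assumes "\<And>P. prime_ideal P \<Longrightarrow> I \<subseteq> P \<Longrightarrow> prime_chain k P"
  shows "enat k \<le> ideal_height I"
  unfolding ideal_height_def prime_height_eq using assms
  by (intro Inf_greatest) (auto intro: Sup_upper)

lemma ideal_height_le:
  assumes "prime_ideal P" "I \<subseteq> P" "\<And>l. prime_chain l P \<Longrightarrow> l \<le> k"
  shows "ideal_height I \<le> enat k"
proof -
  have "ideal_height I \<le> prime_height P"
    unfolding ideal_height_def using assms by (intro Inf_lower) blast
  also have "\<dots> \<le> enat k" unfolding prime_height_eq using assms by (intro Sup_least) auto
  finally show ?thesis .
qed

section \<open>Binomials and lattices\<close>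

abbreviation "lookup \<equiv> Poly_Mapping.lookup"
abbreviation "keys \<equiv> Poly_Mapping.keys"
abbreviation "single \<equiv> Poly_Mapping.single"

lemma poly_mapping_sum_singles: "(\<Sum>u\<in>keys f. single u (lookup f u)) = f"
proof (rule poly_mapping_eqI)
  fix v
  have "lookup (\<Sum>u\<in>keys f. single u (lookup f u)) v =
      (\<Sum>u\<in>keys f. if u = v then lookup f u else 0)"
    by (simp add: lookup_sum lookup_single when_def)
  also have "\<dots> = lookup f v" by (simp add: in_keys_iff)
  finally show "lookup (\<Sum>u\<in>keys f. single u (lookup f u)) v = lookup f v" .
qed

lemma poly_mapping_sum_singles_UNIV:
  fixes f :: "'m::finite \<Rightarrow>\<^sub>0 'a::comm_monoid_add"
  shows "(\<Sum>u\<in>UNIV. single u (lookup f u)) = f"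
proof -
  have "(\<Sum>u\<in>UNIV. single u (lookup f u)) = (\<Sum>u\<in>keys f. single u (lookup f u))"
    by (intro sum.mono_neutral_right) (auto simp: in_keys_iff)
  then show ?thesis by (simp add: poly_mapping_sum_singles)
qed

lemma poly_mapping_add_induct [case_names zero single add]:
  fixes f :: "'b \<Rightarrow>\<^sub>0 'a::comm_monoid_add"
  assumes "P 0" "\<And>u a. P (single u a)" "\<And>f g. P f \<Longrightarrow> P g \<Longrightarrow> P (f + g)"
  shows "P f"
proof -
  have "P (\<Sum>u\<in>A. single u (lookup f u))" if "finite A" for A
    using that by (induction A rule: finite_induct) (auto simp: assms)
  from this[of "keys f"] show ?thesis by (simp add: poly_mapping_sum_singles)
qed

lemma sum_keys_superset:
  assumes "\<And>u. h u 0 = 0" "finite A" "keys f \<subseteq> A"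
  shows "(\<Sum>u\<in>keys f. h u (lookup f u)) = (\<Sum>u\<in>A. h u (lookup f u))"
  using assms by (intro sum.mono_neutral_left) (auto simp: in_keys_iff)

text \<open>Cancellation may shrink the support of a sum, so all three sums are taken over the union
  of the supports. This is the source of additivity for the maps defined termwise below.\<close>

lemma sum_keys_add:
  fixes f g :: "'b \<Rightarrow>\<^sub>0 'a::comm_monoid_add"
  assumes "\<And>u. h u 0 = 0" "\<And>u a b. h u (a + b) = h u a + h u b"
  shows "(\<Sum>u\<in>keys (f + g). h u (lookup (f + g) u)) =
    (\<Sum>u\<in>keys f. h u (lookup f u)) + (\<Sum>u\<in>keys g. h u (lookup g u))"
proof -
  let ?A = "keys f \<union> keys g"
  have "keys (f + g) \<subseteq> ?A" by (rule Poly_Mapping.keys_add)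
  then show ?thesis
    using sum_keys_superset[of h ?A f] sum_keys_superset[of h ?A g]
      sum_keys_superset[of h ?A "f + g"] assms
    by (simp add: lookup_add sum.distrib)
qed

definition var :: "'m \<Rightarrow> ('m, 'k::field) mpoly"
  where "var i = single (single i 1) 1"

lemma lookup_sum_const: "lookup (\<Sum>i<n. (u :: 'm \<Rightarrow>\<^sub>0 nat)) j = n * lookup u j"
  by (simp add: lookup_sum)

lemma var_power: "(var i :: ('m, 'k::field) mpoly) ^ n = single (single i n) 1"
  by (induction n) (auto simp: var_def mult_single simp flip: single_add)

lemma prod_single_one:
  "finite A \<Longrightarrow> (\<Prod>i\<in>A. single (f i) 1 :: ('m, 'k::field) mpoly) = single (\<Sum>i\<in>A. f i) 1"
  by (induction A rule: finite_induct) (auto simp: mult_single)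

lemma monomial_eq_prod:
  "(single u 1 :: ('m::finite, 'k::field) mpoly) = (\<Prod>i\<in>UNIV. var i ^ lookup u i)"
  by (simp add: var_power prod_single_one poly_mapping_sum_singles_UNIV)

lemma single_eq_const_mult:
  "(single u c :: ('m, 'k::field) mpoly) = single 0 c * single u 1"
  by (simp add: mult_single)

lemma single_mem_ideal_iff:
  assumes "is_ideal (I :: ('m, 'k::field) mpoly set)" "c \<noteq> 0"
  shows "single u c \<in> I \<longleftrightarrow> single u 1 \<in> I"
proof -
  have "single u 1 = single 0 (inverse c) * single u c" using assms(2) by (simp add: mult_single)
  then show ?thesis
    using ideal_mult_left[OF assms(1)] single_eq_const_mult[of u c] by metis
qed

lemma single_mem_prime_iff:
  assumes "prime_ideal (Q :: ('m::finite, 'k::field) mpoly set)" "c \<noteq> 0"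
  shows "single u c \<in> Q \<longleftrightarrow> (\<exists>i\<in>keys u. var i \<in> Q)"
proof -
  have "single u c \<in> Q \<longleftrightarrow> (\<exists>i. var i ^ lookup u i \<in> Q)"
    using assms by (simp add: single_mem_ideal_iff prime_ideal_is_ideal monomial_eq_prod prime_ideal_prod)
  also have "\<dots> \<longleftrightarrow> (\<exists>i\<in>keys u. var i \<in> Q)"
    by (metis assms(1) in_keys_iff neq0_conv power_0 prime_ideal_one prime_ideal_power)
  finally show ?thesis .
qed

section \<open>Exponent vectors and translated binomials\<close>

definition exponent_vec :: "('m \<Rightarrow>\<^sub>0 nat) \<Rightarrow> int ^ 'm"
  where "exponent_vec u = (\<chi> i. int (lookup u i))"

lemma exponent_vec_nth [simp]: "exponent_vec u $ i = int (lookup u i)"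
  by (simp add: exponent_vec_def)

lemma exponent_vec_add: "exponent_vec (u + v) = exponent_vec u + exponent_vec v"
  by (simp add: vec_eq_iff lookup_add)

lemma lookup_pos_part: "lookup (pos_part w) i = nat (w $ i)"
  by (simp add: pos_part_def lookup_sum lookup_single when_def)

lemma lookup_neg_part: "lookup (neg_part w) i = nat (- (w $ i))"
  by (simp add: neg_part_def lookup_sum lookup_single when_def)

lemma exponent_vec_pos_neg: "exponent_vec (pos_part w) - exponent_vec (neg_part w) = w"
  by (simp add: vec_eq_iff lookup_pos_part lookup_neg_part)

text \<open>The positive and the negative part have disjoint supports, so what remains of
  \<open>u\<close> and \<open>v\<close> is their common monomial factor.\<close>

lemma exponent_decompose:
  assumes "exponent_vec u - exponent_vec v = w"
  shows "\<exists>t. u = pos_part w + t \<and> v = neg_part w + t"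
proof -
  \<comment> \<open>Truncated subtraction is exact here, since \<open>u\<close> dominates
    \<open>pos_part w\<close> in each coordinate.\<close>
  define t where "t = u - pos_part w"
  have uv: "int (lookup u i) - int (lookup v i) = w $ i" for i
    using assms by (metis exponent_vec_nth vector_minus_component)
  have t: "lookup t i = lookup u i - nat (w $ i)" for i
    by (simp add: t_def minus_poly_mapping.rep_eq lookup_pos_part)
  have "lookup u i = nat (w $ i) + lookup t i \<and> lookup v i = nat (- (w $ i)) + lookup t i" for i
    using uv[of i] by (auto simp: t)
  then show ?thesis
    by (intro exI[of _ t]) (auto intro!: poly_mapping_eqI simp: lookup_add lookup_pos_part lookup_neg_part)
qed

lemma lattice_binomial_translate:
  fixes \<rho> :: "int ^ 'm::finite \<Rightarrow> 'k::field"
  assumes "exponent_vec u - exponent_vec v = w"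
  shows "\<exists>t. single u 1 - single v (\<rho> w) = single t 1 * lattice_binomial \<rho> w"
proof -
  obtain t where "u = pos_part w + t" "v = neg_part w + t" using exponent_decompose[OF assms] by blast
  then show ?thesis
    by (intro exI[of _ t]) (simp add: lattice_binomial_def right_diff_distrib mult_single add.commute)
qed

lemma binomial_mem_ideal:
  fixes \<rho> :: "int ^ 'm::finite \<Rightarrow> 'k::field"
  assumes "is_ideal I" "lattice_binomial \<rho> w \<in> I" "exponent_vec u - exponent_vec v = w"
  shows "single u 1 - single v (\<rho> w) \<in> I"
  using lattice_binomial_translate[OF assms(3), of \<rho>] ideal_mult_left[OF assms(1,2)] by metis

text \<open>Where no variable belongs to \<open>Q\<close>, the common monomial factor can be
  cancelled.\<close>

lemma lattice_binomial_mem_prime: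
  fixes \<rho> :: "int ^ 'm::finite \<Rightarrow> 'k::field"
  assumes "prime_ideal Q" "\<And>i. var i \<notin> Q"
    and "single u 1 - single v (\<rho> w) \<in> Q" "exponent_vec u - exponent_vec v = w"
  shows "lattice_binomial \<rho> w \<in> Q"
proof -
  obtain t where "single u 1 - single v (\<rho> w) = single t 1 * lattice_binomial \<rho> w"
    using lattice_binomial_translate[OF assms(4)] by blast
  then show ?thesis
    using assms by (simp add: prime_ideal_mult single_mem_prime_iff)
qed

section \<open>Lattices and partial characters\<close>

lemma group_additive_group: "group (additive_group :: 'a::ab_group_add monoid)"
  by (rule groupI) (auto simp: additive_group_def add.assoc intro: exI[of _ "- x" for x])

lemma inv_additive_group: "inv\<^bsub>additive_group\<^esub> x = - (x :: 'a::ab_group_add)"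
  by (rule group.inv_equality[OF group_additive_group]) (auto simp: additive_group_def)

definition is_lattice :: "(int ^ 'm) set \<Rightarrow> bool"
  where "is_lattice L \<longleftrightarrow> 0 \<in> L \<and> (\<forall>u\<in>L. \<forall>v\<in>L. u + v \<in> L) \<and> (\<forall>u\<in>L. - u \<in> L)"

lemma subgroup_additive_group_iff: "subgroup L additive_group \<longleftrightarrow> is_lattice L"
  by (auto simp: subgroup_def is_lattice_def inv_additive_group) (auto simp: additive_group_def)

lemma latticeD:
  assumes "is_lattice L"
  shows lattice_zero: "0 \<in> L"
    and lattice_add: "u \<in> L \<Longrightarrow> v \<in> L \<Longrightarrow> u + v \<in> L"
    and lattice_uminus: "u \<in> L \<Longrightarrow> - u \<in> L"
    and lattice_diff: "u \<in> L \<Longrightarrow> v \<in> L \<Longrightarrow> u - v \<in> L"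
  using assms by (auto simp: is_lattice_def) (metis diff_conv_add_uminus)

lemma lattice_scale:
  assumes "is_lattice L" "u \<in> L"
  shows "c *s u \<in> L"
proof (induction c rule: int_induct[of _ 0])
  case base
  then show ?case by (simp add: lattice_zero assms)
next
  case (step1 i)
  have "(i + 1) *s u = i *s u + u" by (simp add: vec_eq_iff algebra_simps)
  then show ?case using assms step1 by (simp add: lattice_add)
next
  case (step2 i)
  have "(i - 1) *s u = i *s u - u" by (simp add: vec_eq_iff algebra_simps)
  then show ?case using assms step2 by (simp add: lattice_diff)
qed

lemma lattice_sum: "is_lattice L \<Longrightarrow> (\<And>i. i \<in> A \<Longrightarrow> f i \<in> L) \<Longrightarrow> sum f A \<in> L"
  by (induction A rule: infinite_finite_induct) (auto simp: lattice_zero lattice_add)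

lemma partial_characterD:
  assumes "partial_character L \<rho>"
  shows partial_character_lattice: "is_lattice L"
    and partial_character_nonzero: "u \<in> L \<Longrightarrow> \<rho> u \<noteq> 0"
    and partial_character_add: "u \<in> L \<Longrightarrow> v \<in> L \<Longrightarrow> \<rho> (u + v) = \<rho> u * \<rho> v"
    and partial_character_zero: "\<rho> 0 = 1"
    and partial_character_uminus: "u \<in> L \<Longrightarrow> \<rho> (- u) = inverse (\<rho> u)"
proof -
  show L: "is_lattice L" using assms by (simp add: partial_character_def subgroup_additive_group_iff)
  show nz: "u \<in> L \<Longrightarrow> \<rho> u \<noteq> 0" for u
    using assms by (auto simp: partial_character_def hom_def unit_group_def)
  show add: "u \<in> L \<Longrightarrow> v \<in> L \<Longrightarrow> \<rho> (u + v) = \<rho> u * \<rho> v" for u v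
    using assms by (auto simp: partial_character_def hom_def unit_group_def additive_group_def)
  show zero: "\<rho> 0 = 1"
    using add[of 0 0] nz[of 0] lattice_zero[OF L] by simp
  show "u \<in> L \<Longrightarrow> \<rho> (- u) = inverse (\<rho> u)" for u
    using add[of u "- u"] zero lattice_uminus[OF L] by (simp add: inverse_unique)
qed

text \<open>On the torus the equation x^w = \<rho>(w) is multiplicative in \<open>w\<close>, so the
  exponents for which it holds form a subgroup. Monomial factors that arise are cancelled by
  \<open>lattice_binomial_mem_prime\<close>.\<close>

lemma lattice_vanishing:
  fixes \<rho> :: "int ^ 'm::finite \<Rightarrow> 'k::field"
  assumes \<rho>: "partial_character L \<rho>" and Q: "prime_ideal Q" and var: "\<And>i. var i \<notin> Q"
  shows "is_lattice {w \<in> L. lattice_binomial \<rho> w \<in> Q}"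
  unfolding is_lattice_def
proof (intro conjI ballI; clarsimp; (intro conjI)?)
  note L = partial_character_lattice[OF \<rho>] and I = prime_ideal_is_ideal[OF Q]
  show "0 \<in> L" by (rule lattice_zero[OF L])
  have "pos_part 0 = (0 :: 'm \<Rightarrow>\<^sub>0 nat)" "neg_part 0 = (0 :: 'm \<Rightarrow>\<^sub>0 nat)"
    by (simp_all add: pos_part_def neg_part_def)
  then show "lattice_binomial \<rho> 0 \<in> Q"
    by (simp add: lattice_binomial_def partial_character_zero[OF \<rho>] ideal_zero[OF I])
  fix v assume v: "v \<in> L" "lattice_binomial \<rho> v \<in> Q"
  show "- v \<in> L" using v L by (simp add: lattice_uminus)
  have "single (pos_part v) 1 - single (neg_part v) (\<rho> v) \<in> Q"
    using v by (simp add: lattice_binomial_def)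
  \<comment> \<open>Scaling by -1/\<rho>(v) exchanges the roles of the two monomials.\<close>
  then have "single 0 (- inverse (\<rho> v)) * (single (pos_part v) 1 - single (neg_part v) (\<rho> v)) \<in> Q"
    by (rule ideal_mult_left[OF I])
  also have "single 0 (- inverse (\<rho> v)) * (single (pos_part v) 1 - single (neg_part v) (\<rho> v)) =
      single (neg_part v) 1 - single (pos_part v) (\<rho> (- v))"
    using partial_character_nonzero[OF \<rho> v(1)]
    by (simp add: right_diff_distrib mult_single partial_character_uminus[OF \<rho> v(1)] single_uminus)
  finally show "lattice_binomial \<rho> (- v) \<in> Q"
    by (rule lattice_binomial_mem_prime[OF Q var])
      (simp add: exponent_vec_pos_neg flip: minus_diff_eq[of "exponent_vec (pos_part v)"])
  fix u assume u: "u \<in> L" "lattice_binomial \<rho> u \<in> Q"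
  show "u + v \<in> L" using u v L by (simp add: lattice_add)
  let ?p = "single (pos_part u) 1" and ?n = "single (neg_part u) (\<rho> u)"
  \<comment> \<open>The telescoping p p' - n n' = p (p' - n') + n' (p - n), where p', n' belong to
    \<open>v\<close>.\<close>
  have "?p * lattice_binomial \<rho> v + single (neg_part v) (\<rho> v) * lattice_binomial \<rho> u \<in> Q"
    using u v by (intro ideal_add[OF I] ideal_mult_left[OF I]) auto
  also have "?p * lattice_binomial \<rho> v + single (neg_part v) (\<rho> v) * lattice_binomial \<rho> u =
      single (pos_part u + pos_part v) 1 - single (neg_part u + neg_part v) (\<rho> (u + v))"
    by (simp add: lattice_binomial_def right_diff_distrib mult_single
        partial_character_add[OF \<rho> u(1) v(1)] ac_simps)
  finally show "lattice_binomial \<rho> (u + v) \<in> Q"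
    by (rule lattice_binomial_mem_prime[OF Q var])
      (simp add: exponent_vec_add add_diff_add exponent_vec_pos_neg)
qed

section \<open>Upper bounds for the arithmetical rank\<close>

lemma CHAR_poly_mapping:
  "CHAR('b::comm_monoid_add \<Rightarrow>\<^sub>0 'a::comm_semiring_1) = CHAR('a)"
  by (rule CHAR_eqI)
    (simp_all add: of_nat_eq_0_iff_char_dvd flip: single_of_nat,
     metis lookup_single_eq lookup_zero of_nat_eq_0_iff_char_dvd)

lemma single_power:
  "(single u c :: ('m, 'k::field) mpoly) ^ n = single (\<Sum>i<n. u) (c ^ n)"
  by (induction n) (auto simp: mult_single add.commute)

lemma partial_character_scale:
  assumes "partial_character L \<rho>" "u \<in> L"
  shows "\<rho> (int n *s u) = \<rho> u ^ n"
proof (induction n)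
  case (Suc n)
  have "int (Suc n) *s u = u + int n *s u" by (simp add: vec_eq_iff algebra_simps)
  then show ?case
    using Suc assms lattice_scale[OF partial_character_lattice[OF assms(1)] assms(2)]
    by (simp add: partial_character_add)
qed (simp add: partial_character_zero[OF assms(1)])

text \<open>Frobenius is additive, so the power is taken termwise; the outcome is the binomial of
  the multiple of \<open>v\<close> by \<open>q\<close>.\<close>

lemma lattice_binomial_power_char:
  fixes \<rho> :: "int ^ 'm::finite \<Rightarrow> 'k::field"
  assumes \<rho>: "partial_character L \<rho>" and v: "v \<in> L" and char: "0 < CHAR('k)"
    and q: "q = CHAR('k) ^ e"
  shows "lattice_binomial \<rho> v ^ q =
    single (\<Sum>i<q. pos_part v) 1 - single (\<Sum>i<q. neg_part v) (\<rho> (int q *s v))"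
proof -
  let ?b = "single (neg_part v) (\<rho> v)"
  have "(lattice_binomial \<rho> v + ?b) ^ q = lattice_binomial \<rho> v ^ q + ?b ^ q"
    using prime_CHAR_semidom[OF char] by (intro freshmans_dream'[of q e]) (simp_all add: CHAR_poly_mapping q)
  moreover have "lattice_binomial \<rho> v + ?b = single (pos_part v) 1" by (simp add: lattice_binomial_def)
  ultimately have "lattice_binomial \<rho> v ^ q = single (pos_part v) 1 ^ q - ?b ^ q" by simp
  then show ?thesis by (simp only: single_power partial_character_scale[OF \<rho> v] power_one)
qed

definition lattice_span :: "(int ^ 'm) set \<Rightarrow> (int ^ 'm) set"
  where "lattice_span U = \<Inter>{M. is_lattice M \<and> U \<subseteq> M}"

lemma lattice_lattice_span: "is_lattice (lattice_span U)"
  by (auto simp: lattice_span_def is_lattice_def)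

lemma lattice_span_superset: "U \<subseteq> lattice_span U"
  by (auto simp: lattice_span_def)

lemma lattice_span_minimal: "is_lattice M \<Longrightarrow> U \<subseteq> M \<Longrightarrow> lattice_span U \<subseteq> M"
  by (auto simp: lattice_span_def)

lemma lattice_span_mono: "U \<subseteq> V \<Longrightarrow> lattice_span U \<subseteq> lattice_span V"
  by (auto simp: lattice_span_def)

text \<open>The common shape of the identities by which the two inductions below show membership in
  the enlarged span.\<close>

lemma lattice_combination:
  assumes "is_lattice M" "a \<in> M" "b \<in> M" "c \<in> M" "d \<in> M"
  shows "a + i *s b - j *s c + k *s d \<in> M"
  using assms by (intro lattice_add lattice_diff lattice_scale)

text \<open>For the configuration \<open>A\<close> of the lattice, the existence of the vectors \<open>w s\<close> says that each
  \<open>a\<^sub>s\<close> with \<open>s \<notin> J\<close> is a strictly positive rational combination of the \<open>a\<^sub>j\<close> with \<open>j \<in> J\<close>,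
  with a common denominator \<open>N\<close>.\<close>

locale full_lattice =
  fixes L :: "(int ^ 'm::finite) set" and J :: "'m set" and N :: int and w :: "'m \<Rightarrow> int ^ 'm"
  assumes lattice_L: "is_lattice L"
    and independent: "\<And>v. v \<in> L \<Longrightarrow> (\<And>i. i \<notin> J \<Longrightarrow> v $ i = 0) \<Longrightarrow> v = 0"
    and N_pos: "0 < N"
    and w_mem: "\<And>s. s \<notin> J \<Longrightarrow> w s \<in> L"
    and w_diag: "\<And>s. s \<notin> J \<Longrightarrow> w s $ s = N"
    and w_off: "\<And>s i. s \<notin> J \<Longrightarrow> i \<notin> J \<Longrightarrow> i \<noteq> s \<Longrightarrow> w s $ i = 0"
    and w_neg: "\<And>s j. s \<notin> J \<Longrightarrow> j \<in> J \<Longrightarrow> w s $ j < 0"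
begin

text \<open>The vectors \<open>w s\<close> are diagonal outside of \<open>J\<close>, so subtracting
  their combination leaves a vector supported in \<open>J\<close>, which is 0 by
  \<open>independent\<close>. Thus the \<open>w s\<close> form a rational basis of the span of
  \<open>L\<close>.\<close>

lemma coordinate:
  assumes "v \<in> L"
  shows "N * v $ k = (\<Sum>s\<in>-J. v $ s * w s $ k)"
proof -
  let ?d = "N *s v - (\<Sum>s\<in>-J. v $ s *s w s)"
  have "?d = 0"
  proof (rule independent)
    show "?d \<in> L"
      using assms w_mem lattice_L by (auto intro!: lattice_diff lattice_scale lattice_sum)
    fix i assume i: "i \<notin> J"
    have "(\<Sum>s\<in>-J. v $ s * w s $ i) = (\<Sum>s\<in>{i}. v $ s * w s $ i)"
      using i w_off by (intro sum.mono_neutral_right) auto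
    then show "?d $ i = 0" using i by (simp add: w_diag)
  qed
  then have "?d $ k = 0" by simp
  then show ?thesis by simp
qed

text \<open>In \<open>coordinate\<close> each term is a product of two nonpositive numbers, and at
  least one term is positive, because a nonzero \<open>u\<close> has a nonzero entry outside of
  \<open>J\<close>.\<close>

lemma nonneg_on_J:
  assumes u: "u \<in> L" "u \<noteq> 0" and neg: "\<And>s. s \<notin> J \<Longrightarrow> u $ s \<le> 0" and k: "k \<in> J"
  shows "0 < u $ k"
proof -
  obtain s where s: "s \<notin> J" "u $ s \<noteq> 0" using independent[OF u(1)] u(2) by blast
  have "0 < (\<Sum>s\<in>-J. u $ s * w s $ k)"
  proof (rule sum_pos2[of _ s])
    show "0 < u $ s * w s $ k"
      using s neg[OF s(1)] w_neg[OF s(1) k] by (simp add: mult_neg_neg)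
    show "0 \<le> u $ i * w i $ k" if "i \<in> -J" for i
      using neg[of i] w_neg[of i k] k that by (simp add: mult_nonpos_nonpos)
  qed (use s in auto)
  then show ?thesis using coordinate[OF u(1), of k] N_pos by (metis zero_less_mult_pos)
qed

text \<open>Every nonzero vector of \<open>L\<close> has a positive entry at an index whose variable
  is in \<open>Q\<close>: either outside of \<open>J\<close>, or at \<open>k\<close> by
  \<open>nonneg_on_J\<close>. Applied to \<open>u\<close> and its negative, this puts both monomials
  into \<open>Q\<close>.\<close>

lemma boundary:
  fixes \<rho> :: "int ^ 'm \<Rightarrow> 'k::field"
  assumes \<rho>: "partial_character L \<rho>" and Q: "prime_ideal Q"
    and k: "k \<in> J" "var k \<in> Q" and off: "\<And>s. s \<notin> J \<Longrightarrow> var s \<in> Q" and u: "u \<in> L"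
  shows "lattice_binomial \<rho> u \<in> Q"
proof (cases "u = 0")
  case True
  then have "pos_part u = (0 :: 'm \<Rightarrow>\<^sub>0 nat)" "neg_part u = (0 :: 'm \<Rightarrow>\<^sub>0 nat)"
    by (simp_all add: pos_part_def neg_part_def)
  then show ?thesis
    using True Q by (simp add: lattice_binomial_def partial_character_zero[OF \<rho>] ideal_zero prime_ideal_is_ideal)
next
  case False
  have pos: "\<exists>i. 0 < v $ i \<and> var i \<in> Q" if "v \<in> L" "v \<noteq> 0" for v
    using nonneg_on_J[OF that _ k(1)] k(2) off by (meson not_less)
  obtain i where i: "0 < u $ i" "var i \<in> Q" using pos[OF u False] by blast
  obtain j where j: "u $ j < 0" "var j \<in> Q"
    using pos[of "- u"] u False lattice_uminus[OF lattice_L] by auto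
  have "single (pos_part u) 1 \<in> Q"
    using i by (subst single_mem_prime_iff[OF Q]) (auto simp: in_keys_iff lookup_pos_part intro!: bexI[of _ i])
  moreover have "single (neg_part u) (\<rho> u) \<in> Q"
    using j partial_character_nonzero[OF \<rho> u]
    by (subst single_mem_prime_iff[OF Q]) (auto simp: in_keys_iff lookup_neg_part intro!: bexI[of _ j])
  ultimately show ?thesis
    by (simp add: lattice_binomial_def ideal_diff prime_ideal_is_ideal[OF Q])
qed

text \<open>The filtration along which the binomials are constructed: it runs from 0 at empty
  \<open>S\<close> to \<open>L\<close> at \<open>S = -J\<close>.\<close>

definition section_lattice :: "'m set \<Rightarrow> (int ^ 'm) set"
  where "section_lattice S = {u \<in> L. \<forall>i. i \<notin> J \<longrightarrow> i \<notin> S \<longrightarrow> u $ i = 0}"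

lemma lattice_section: "is_lattice (section_lattice S)"
  using lattice_L by (auto simp: section_lattice_def is_lattice_def)

text \<open>The entries at \<open>y\<close> form a subgroup of \<int>, which is generated by its
  least positive element.\<close>

lemma section_generator:
  assumes "y \<notin> J" "y \<notin> S"
  shows "\<exists>u\<in>section_lattice (insert y S). 0 < u $ y \<and>
    (\<forall>v\<in>section_lattice (insert y S). \<exists>c. v - c *s u \<in> section_lattice S)"
proof -
  let ?L = "section_lattice (insert y S)"
  let ?P = "\<lambda>g. 0 < g \<and> (\<exists>u\<in>?L. u $ y = int g)"
  define g where "g = (LEAST g. ?P g)"
  \<comment> \<open>\<open>w y\<close> witnesses that a positive entry occurs.\<close>
  have "?P (nat N)"
    using assms w_mem[of y] w_off[of y] w_diag[of y] N_pos
    by (auto simp: section_lattice_def intro!: exI[of _ "w y"])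
  then have "?P g" unfolding g_def by (rule LeastI)
  then obtain u where u: "0 < g" "u \<in> ?L" "u $ y = int g" by blast
  have "\<exists>c. v - c *s u \<in> section_lattice S" if v: "v \<in> ?L" for v
  proof -
    define v' where "v' = v - (v $ y div int g) *s u"
    have v': "v' \<in> ?L" using u v by (auto simp: v'_def intro: lattice_diff lattice_scale lattice_section)
    have y: "v' $ y = v $ y mod int g"
      by (simp add: v'_def u(3) minus_div_mult_eq_mod)
    have "v' $ y = 0"
    proof (rule ccontr)
      assume "v' $ y \<noteq> 0"
      moreover have "0 \<le> v' $ y" "v' $ y < int g" using u(1) by (simp_all add: y)
      ultimately have r: "0 < nat (v' $ y)" "v' $ y = int (nat (v' $ y))" "nat (v' $ y) < g" by linarith+
      then have "?P (nat (v' $ y))" using v' by blast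
      then have "g \<le> nat (v' $ y)" unfolding g_def by (rule Least_le)
      then show False using r(3) by simp
    qed
    then have "v' \<in> section_lattice S" using v' by (auto simp: section_lattice_def)
    then show ?thesis unfolding v'_def by blast
  qed
  then show ?thesis using u by (intro bexI[of _ u]) simp_all
qed

text \<open>Adding multiples of \<open>t\<close> times the \<open>w s\<close> brings the entries on
  \<open>S\<close> into a bounded range below 0, independent of \<open>q\<close>, while the entry at
  \<open>y\<close> grows with \<open>q\<close>. By \<open>coordinate\<close> the term of
  \<open>y\<close> then dominates and makes all entries on \<open>J\<close> negative. The factor
  \<open>t\<close> will keep the correction inside the lattice spanned before.\<close>

lemma section_vector:
  assumes y: "y \<notin> J" "y \<notin> S" and S: "S \<subseteq> -J" and t: "0 < t"
    and u: "u \<in> section_lattice (insert y S)" "0 < u $ y"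
  shows "\<exists>B>0. \<forall>q\<ge>B. \<exists>z.
    (let l = q *s u + t *s (\<Sum>s\<in>S. z s *s w s) in
      l \<in> section_lattice (insert y S) \<and> 0 < l $ y \<and> (\<forall>s\<in>S. l $ s \<le> 0) \<and> (\<forall>j\<in>J. l $ j < 0))"
proof (intro exI conjI allI impI)
  let ?M = "t * N"
  have M: "0 < ?M" using t N_pos by simp
  \<comment> \<open>A bound for the contribution of \<open>S\<close> to every coordinate at once,
    plus 1 for strictness.\<close>
  let ?B = "1 + (\<Sum>j\<in>UNIV. \<Sum>s\<in>S. ?M * \<bar>w s $ j\<bar>)"
  have nn: "0 \<le> ?M * \<bar>x\<bar>" for x using M by (intro mult_nonneg_nonneg order_less_imp_le[OF M]) auto
  show "0 < ?B" by (intro add_pos_nonneg sum_nonneg nn) auto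
  fix q assume q: "?B \<le> q"
  \<comment> \<open>Rounding by \<open>div\<close> leaves minus a remainder modulo \<open>?M\<close>
    as the entry at \<open>s\<close>, hence a value between \<open>- ?M\<close> and 0.\<close>
  define z where "z s = (- (q * u $ s)) div ?M" for s
  define l where "l = q *s u + t *s (\<Sum>s\<in>S. z s *s w s)"
  have wS: "w s \<in> section_lattice (insert y S)" if "s \<in> S" for s
    using that S w_mem w_off by (auto simp: section_lattice_def)
  have mem: "l \<in> section_lattice (insert y S)"
    unfolding l_def using wS u lattice_section by (intro lattice_add lattice_scale lattice_sum)
  have sum_off: "(\<Sum>s\<in>S. z s * w s $ i) = (if i \<in> S then z i * N else 0)" if "i \<notin> J" for i
  proof -
    have "(\<Sum>s\<in>S. z s * w s $ i) = (\<Sum>s\<in>S. if s = i then z i * N else 0)"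
      using S that w_off w_diag by (intro sum.cong) auto
    then show ?thesis by simp
  qed
  have ly: "l $ y = q * u $ y" using sum_off[OF y(1)] y(2) by (simp add: l_def)
  have ls: "l $ s = - ((- (q * u $ s)) mod ?M)" if "s \<in> S" for s
  proof -
    have "l $ s = q * u $ s + z s * ?M" using sum_off[of s] that S by (auto simp: l_def)
    also have "\<dots> = - ((- (q * u $ s)) mod ?M)"
      unfolding z_def by (simp add: minus_mult_div_eq_mod [symmetric] mult.commute)
    finally show ?thesis .
  qed
  have ls_bounds: "l $ s \<le> 0" "- ?M \<le> l $ s" if "s \<in> S" for s
    using ls[OF that] M by (simp_all add: order_less_imp_le)
  have q0: "0 < q" using q \<open>0 < ?B\<close> by linarith
  have lj: "l $ j < 0" if j: "j \<in> J" for j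
  proof -
    have lL: "l \<in> L" using mem by (simp add: section_lattice_def)
    have "N * l $ j = (\<Sum>s\<in>-J. l $ s * w s $ j)" by (rule coordinate[OF lL])
    also have "\<dots> = (\<Sum>s\<in>insert y S. l $ s * w s $ j)"
      using mem S y by (intro sum.mono_neutral_right) (auto simp: section_lattice_def)
    also have "\<dots> = q * u $ y * w y $ j + (\<Sum>s\<in>S. l $ s * w s $ j)" using y by (simp add: ly)
    \<comment> \<open>Both \<open>u $ y\<close> and \<open>- w y $ j\<close> are positive integers,
      so the term of \<open>y\<close> is at most \<open>- q\<close>.\<close>
    also have "q * u $ y * w y $ j \<le> q * (-1)"
    proof -
      have "u $ y * w y $ j \<le> 1 * (-1)"
        using mult_right_mono_neg[of 1 "u $ y" "w y $ j"] u(2) w_neg[OF y(1) j] by linarith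
      then show ?thesis using q0 mult_left_mono[of "u $ y * w y $ j" "-1" q] by (simp add: mult.assoc)
    qed
    also have "(\<Sum>s\<in>S. l $ s * w s $ j) \<le> (\<Sum>s\<in>S. ?M * \<bar>w s $ j\<bar>)"
    proof (rule sum_mono)
      fix s assume s: "s \<in> S"
      have "l $ s * w s $ j \<le> \<bar>l $ s\<bar> * \<bar>w s $ j\<bar>" by (metis abs_ge_self abs_mult)
      also have "\<dots> \<le> ?M * \<bar>w s $ j\<bar>" using ls_bounds[OF s] by (intro mult_right_mono) auto
      finally show "l $ s * w s $ j \<le> ?M * \<bar>w s $ j\<bar>" .
    qed
    also have "(\<Sum>s\<in>S. ?M * \<bar>w s $ j\<bar>) \<le> (\<Sum>j\<in>UNIV. \<Sum>s\<in>S. ?M * \<bar>w s $ j\<bar>)"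
      by (rule member_le_sum) (auto intro!: sum_nonneg nn simp del: mult_pos_pos)
    finally have "N * l $ j < 0" using q by simp
    then show ?thesis using N_pos by (metis mult_less_0_iff not_less_iff_gr_or_eq)
  qed
  show "let l = q *s u + t *s (\<Sum>s\<in>S. z s *s w s) in
      l \<in> section_lattice (insert y S) \<and> 0 < l $ y \<and> (\<forall>s\<in>S. l $ s \<le> 0) \<and> (\<forall>j\<in>J. l $ j < 0)"
    using mem ly q0 u(2) ls_bounds(1) lj
    by (simp add: l_def[symmetric] Let_def)
qed

text \<open>The zeros of the binomials of such a list are, as far as the coordinates in \<open>S\<close> are concerned,
  either in the torus or contained in the boundary of the cone.\<close>

definition separating :: "(int ^ 'm \<Rightarrow> 'k::field) \<Rightarrow> 'm set \<Rightarrow> (int ^ 'm) list \<Rightarrow> bool"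
  where "separating \<rho> S us \<longleftrightarrow> set us \<subseteq> section_lattice S \<and> length us = card S \<and>
    (\<forall>Q. prime_ideal Q \<longrightarrow> lattice_binomial \<rho> ` set us \<subseteq> Q \<longrightarrow>
      (\<forall>s\<in>S. var s \<in> Q \<longleftrightarrow> (\<exists>j\<in>J. var j \<in> Q)))"

text \<open>The binomial of \<open>l\<close> is a power of \<open>var y\<close> minus a multiple of
  a monomial that involves all of \<open>J\<close> and otherwise only \<open>S\<close>. A prime
  containing it contains \<open>var y\<close> exactly if it contains some variable of this monomial,
  and those of \<open>S\<close> reduce to \<open>J\<close> by hypothesis.\<close>

lemma separating_Cons:
  fixes \<rho> :: "int ^ 'm \<Rightarrow> 'k::field"
  assumes \<rho>: "partial_character L \<rho>" and y: "y \<notin> J" "y \<notin> S" and S: "S \<subseteq> -J"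
    and sep: "separating \<rho> S us"
    and l: "l \<in> section_lattice (insert y S)" "0 < l $ y" "\<And>s. s \<in> S \<Longrightarrow> l $ s \<le> 0"
      "\<And>j. j \<in> J \<Longrightarrow> l $ j < 0"
  shows "separating \<rho> (insert y S) (l # us)"
  unfolding separating_def
proof (intro conjI allI impI)
  show "set (l # us) \<subseteq> section_lattice (insert y S)"
    using sep l(1) by (auto simp: separating_def section_lattice_def)
  show "length (l # us) = card (insert y S)" using sep y by (simp add: separating_def)
  fix Q :: "('m, 'k) mpoly set"
  assume Q: "prime_ideal Q" and B: "lattice_binomial \<rho> ` set (l # us) \<subseteq> Q"
  have S_iff: "var s \<in> Q \<longleftrightarrow> (\<exists>j\<in>J. var j \<in> Q)" if "s \<in> S" for s
    using sep Q B that by (auto simp: separating_def)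
  have lL: "l \<in> L" and l0: "\<And>i. i \<notin> J \<Longrightarrow> i \<notin> S \<Longrightarrow> i \<noteq> y \<Longrightarrow> l $ i = 0"
    using l(1) by (auto simp: section_lattice_def)
  have pos: "keys (pos_part l) = {y}"
    using l l0 by (auto simp: in_keys_iff lookup_pos_part) (metis less_le_not_le linorder_not_less)
  have "single (pos_part l) 1 \<in> Q \<longleftrightarrow> single (neg_part l) (\<rho> l) \<in> Q"
    using B by (intro ideal_diff_iff prime_ideal_is_ideal Q) (simp add: lattice_binomial_def)
  then have "var y \<in> Q \<longleftrightarrow> (\<exists>i\<in>keys (neg_part l). var i \<in> Q)"
    by (simp add: single_mem_prime_iff[OF Q] partial_character_nonzero[OF \<rho> lL] pos)
  moreover have "keys (neg_part l) \<subseteq> J \<union> S"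
  proof
    fix i assume "i \<in> keys (neg_part l)"
    then have "l $ i < 0" by (simp add: in_keys_iff lookup_neg_part)
    then show "i \<in> J \<union> S" using l(2) l0[of i] by (cases "i = y") auto
  qed
  moreover have "J \<subseteq> keys (neg_part l)"
    using l(4) by (auto simp: in_keys_iff lookup_neg_part not_le)
  ultimately have "var y \<in> Q \<longleftrightarrow> (\<exists>j\<in>J. var j \<in> Q)" using S_iff by blast
  then show "\<forall>s\<in>insert y S. var s \<in> Q \<longleftrightarrow> (\<exists>j\<in>J. var j \<in> Q)" using S_iff by blast
qed

text \<open>The multiplier \<open>q\<close> is left free above a bound, because the two inductions
  below choose it differently. Since \<open>t\<close> annihilates the previous section modulo the
  span of \<open>us\<close>, the correction \<open>l\<close> lies in that span.\<close>

lemma separating_extend: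
  fixes \<rho> :: "int ^ 'm \<Rightarrow> 'k::field"
  assumes \<rho>: "partial_character L \<rho>" and y: "y \<notin> J" "y \<notin> S" and S: "S \<subseteq> -J"
    and sep: "separating \<rho> S us"
    and t: "0 < t" "\<forall>v\<in>section_lattice S. t *s v \<in> lattice_span (set us)"
  shows "\<exists>u\<in>section_lattice (insert y S). \<exists>B>0.
    (\<forall>v\<in>section_lattice (insert y S). \<exists>c. v - c *s u \<in> section_lattice S) \<and>
    (\<forall>q\<ge>B. \<exists>l\<in>lattice_span (set us). separating \<rho> (insert y S) ((q *s u + l) # us))"
proof -
  obtain u where u: "u \<in> section_lattice (insert y S)" "0 < u $ y"
    and gen: "\<forall>v\<in>section_lattice (insert y S). \<exists>c. v - c *s u \<in> section_lattice S"
    using section_generator[OF y] by (elim bexE conjE)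
  obtain B where B: "0 < B" and vec: "\<forall>q\<ge>B. \<exists>z.
    (let l = q *s u + t *s (\<Sum>s\<in>S. z s *s w s) in
      l \<in> section_lattice (insert y S) \<and> 0 < l $ y \<and> (\<forall>s\<in>S. l $ s \<le> 0) \<and> (\<forall>j\<in>J. l $ j < 0))"
    using section_vector[OF y S t(1) u] by (elim exE conjE)
  have "\<exists>l\<in>lattice_span (set us). separating \<rho> (insert y S) ((q *s u + l) # us)" if q: "B \<le> q" for q
  proof -
    obtain z where z: "let l = q *s u + t *s (\<Sum>s\<in>S. z s *s w s) in
      l \<in> section_lattice (insert y S) \<and> 0 < l $ y \<and> (\<forall>s\<in>S. l $ s \<le> 0) \<and> (\<forall>j\<in>J. l $ j < 0)"
      using vec[rule_format, OF q] by (elim exE)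
    have "w s \<in> section_lattice S" if "s \<in> S" for s
      using that S w_mem w_off by (auto simp: section_lattice_def)
    then have "t *s (\<Sum>s\<in>S. z s *s w s) \<in> lattice_span (set us)"
      by (intro t(2)[rule_format] lattice_sum lattice_scale lattice_section)
    then show ?thesis
      using separating_Cons[OF \<rho> y S sep] z unfolding Let_def by blast
  qed
  then show ?thesis using u(1) B gen by (intro bexI[of _ u] exI[of _ B] conjI) simp_all
qed

lemma separating_empty: "separating \<rho> {} []"
  using lattice_zero[OF lattice_L] by (auto simp: separating_def)

lemma section_empty: "section_lattice {} = {0}"
  using independent lattice_zero[OF lattice_L] by (auto simp: section_lattice_def)

lemma section_compl: "section_lattice (-J) = L"
  by (auto simp: section_lattice_def)

text \<open>If \<open>p ^ e\<close> annihilates the previous quotient and the new multiplier is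
  \<open>p ^ f\<close>, then \<open>p ^ (e + f)\<close> annihilates the new quotient.\<close>

lemma separating_prime_power:
  fixes \<rho> :: "int ^ 'm \<Rightarrow> 'k::field"
  assumes \<rho>: "partial_character L \<rho>" and p: "2 \<le> p" and "S \<subseteq> -J"
  shows "\<exists>us e. separating \<rho> S us \<and>
    (\<forall>v\<in>section_lattice S. int p ^ e *s v \<in> lattice_span (set us))"
  using finite[of S] \<open>S \<subseteq> -J\<close>
proof (induction S rule: finite_induct)
  case empty
  show ?case
    using separating_empty[of \<rho>] section_empty lattice_zero[OF lattice_lattice_span, of "{}"]
    by (intro exI[of _ "[]"] exI[of _ 0]) auto
next
  case (insert y S)
  then obtain us e where sep: "separating \<rho> S us"
    and e: "\<forall>v\<in>section_lattice S. int p ^ e *s v \<in> lattice_span (set us)" by auto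
  have pe: "0 < int p ^ e" using p by simp
  have y: "y \<notin> J" "y \<notin> S" "S \<subseteq> -J" using insert by auto
  obtain u B where u: "u \<in> section_lattice (insert y S)" "0 < B"
    and gen: "\<forall>v\<in>section_lattice (insert y S). \<exists>c. v - c *s u \<in> section_lattice S"
    and ext: "\<forall>q\<ge>B. \<exists>l\<in>lattice_span (set us). separating \<rho> (insert y S) ((q *s u + l) # us)"
    using separating_extend[OF \<rho> y sep pe e] by (elim bexE exE conjE)
  define f where "f = nat B"
  \<comment> \<open>Taking the bound itself as exponent yields a power beyond the bound.\<close>
  have "f < p ^ f" using p by (metis less_exp order_less_le_trans power_mono zero_le)
  then have "B \<le> int p ^ f" using u(2) unfolding f_def by (simp flip: of_nat_power)
  then obtain l where l: "l \<in> lattice_span (set us)"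
    and sep': "separating \<rho> (insert y S) ((int p ^ f *s u + l) # us)" using ext by blast
  let ?us = "(int p ^ f *s u + l) # us"
  have span: "is_lattice (lattice_span (set ?us))" "lattice_span (set us) \<subseteq> lattice_span (set ?us)"
    "int p ^ f *s u + l \<in> lattice_span (set ?us)"
    using lattice_lattice_span lattice_span_mono[of "set us" "set ?us"]
      lattice_span_superset[of "set ?us"] by auto
  have "int p ^ (e + f) *s v \<in> lattice_span (set ?us)" if v: "v \<in> section_lattice (insert y S)" for v
  proof -
    obtain c where c: "v - c *s u \<in> section_lattice S" using gen v by blast
    have "int p ^ (e + f) *s v = 0 + (int p ^ e * c) *s (int p ^ f *s u + l) - (int p ^ e * c) *s l
        + int p ^ f *s (int p ^ e *s (v - c *s u))"
      by (simp add: vec_eq_iff algebra_simps power_add)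
    also have "\<dots> \<in> lattice_span (set ?us)"
      using span(2) l e c by (intro lattice_combination span(1,3) lattice_zero) auto
    finally show ?thesis .
  qed
  then show ?case using sep' by blast
qed

text \<open>The quotient of the section by the span is cyclic with generator
  \<open>u\<^sub>0\<close> and annihilated by \<open>t\<close>. The next multiplier is 1 modulo
  \<open>t\<close>, so the new quotient is an extension of cyclic groups of coprime orders and again
  cyclic.\<close>

lemma separating_cyclic:
  fixes \<rho> :: "int ^ 'm \<Rightarrow> 'k::field"
  assumes \<rho>: "partial_character L \<rho>" and "S \<subseteq> -J"
  shows "\<exists>us u\<^sub>0 t. separating \<rho> S us \<and> u\<^sub>0 \<in> section_lattice S \<and> 0 < t \<and>
    (\<forall>v\<in>section_lattice S. t *s v \<in> lattice_span (set us)) \<and>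
    (\<forall>v\<in>section_lattice S. \<exists>c. v - c *s u\<^sub>0 \<in> lattice_span (set us))"
  using finite[of S] \<open>S \<subseteq> -J\<close>
proof (induction S rule: finite_induct)
  case empty
  have "\<exists>c. v - c *s 0 \<in> lattice_span (set [])" if "v = 0" for v :: "int ^ 'm"
    using that lattice_zero[OF lattice_lattice_span] by (intro exI[of _ 0]) simp
  then show ?case
    using separating_empty[of \<rho>] section_empty lattice_zero[OF lattice_lattice_span, of "{}"]
    by (intro exI[of _ "[]"] exI[of _ 0] exI[of _ 1] conjI ballI) (simp_all only: singleton_iff, simp_all)
next
  case (insert y S)
  then obtain us u\<^sub>0 t where sep: "separating \<rho> S us" and u0: "u\<^sub>0 \<in> section_lattice S" and t0: "0 < t"
    and t: "\<forall>v\<in>section_lattice S. t *s v \<in> lattice_span (set us)"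
    and cyc: "\<And>v. v \<in> section_lattice S \<Longrightarrow> \<exists>c. v - c *s u\<^sub>0 \<in> lattice_span (set us)" by auto
  have y: "y \<notin> J" "y \<notin> S" "S \<subseteq> -J" using insert by auto
  obtain u B where u: "u \<in> section_lattice (insert y S)" and B: "0 < B"
    and gen: "\<forall>v\<in>section_lattice (insert y S). \<exists>c. v - c *s u \<in> section_lattice S"
    and ext: "\<forall>q\<ge>B. \<exists>l\<in>lattice_span (set us). separating \<rho> (insert y S) ((q *s u + l) # us)"
    using separating_extend[OF \<rho> y sep t0 t] by (elim bexE exE conjE)
  \<comment> \<open>a large multiplier coprime to \<open>t\<close>, so that the quotient by the new lattice stays cyclic\<close>
  define q where "q = 1 + t * B"
  have "1 * B \<le> t * B" using t0 B by (intro mult_right_mono) auto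
  then have "B \<le> q" by (simp add: q_def)
  then obtain l where l: "l \<in> lattice_span (set us)"
    and sep': "separating \<rho> (insert y S) ((q *s u + l) # us)" using ext by blast
  let ?us = "(q *s u + l) # us"
  have span: "is_lattice (lattice_span (set ?us))" "lattice_span (set us) \<subseteq> lattice_span (set ?us)"
    "q *s u + l \<in> lattice_span (set ?us)"
    using lattice_lattice_span lattice_span_mono[of "set us" "set ?us"]
      lattice_span_superset[of "set ?us"] by auto
  \<comment> \<open>The coefficient of \<open>u\<^sub>0 + u\<close> solves a Chinese remainder
    problem: it is congruent to \<open>c\<close> modulo \<open>q\<close> and to
    \<open>c\<^sub>0\<close> modulo \<open>t\<close>.\<close>
  have "(t * q) *s v \<in> lattice_span (set ?us) \<and>
      v - (c * (1 - q) + c\<^sub>0 * q) *s (u\<^sub>0 + u) \<in> lattice_span (set ?us)"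
    if c: "v - c *s u \<in> section_lattice S" and c0: "v - c *s u - c\<^sub>0 *s u\<^sub>0 \<in> lattice_span (set us)" for v c c\<^sub>0
  proof
    have "(t * q) *s v = 0 + (t * c) *s (q *s u + l) - (t * c) *s l + q *s (t *s (v - c *s u))"
      by (simp add: vec_eq_iff algebra_simps)
    also have "\<dots> \<in> lattice_span (set ?us)"
      using span(2) l t c by (intro lattice_combination span(1,3) lattice_zero) auto
    finally show "(t * q) *s v \<in> lattice_span (set ?us)" .
    have "v - (c * (1 - q) + c\<^sub>0 * q) *s (u\<^sub>0 + u) = (v - c *s u - c\<^sub>0 *s u\<^sub>0)
        + (c - c\<^sub>0) *s (q *s u + l) - (c - c\<^sub>0) *s l + ((c - c\<^sub>0) * B) *s (t *s u\<^sub>0)"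
      by (simp add: vec_eq_iff algebra_simps q_def)
    also have "\<dots> \<in> lattice_span (set ?us)"
      using span(2) l t u0 c0 by (intro lattice_combination span(1,3)) auto
    finally show "v - (c * (1 - q) + c\<^sub>0 * q) *s (u\<^sub>0 + u) \<in> lattice_span (set ?us)" .
  qed
  moreover have "0 < t * q" using t0 B \<open>B \<le> q\<close> by (intro mult_pos_pos) auto
  moreover have "u\<^sub>0 + u \<in> section_lattice (insert y S)"
    using u u0 by (intro lattice_add lattice_section) (auto simp: section_lattice_def)
  ultimately show ?case using sep' gen cyc by meson
qed

text \<open>A prime that contains the binomials and a variable of \<open>J\<close> contains all
  variables outside of \<open>J\<close>, so \<open>boundary\<close> applies. Otherwise it contains
  no variable at all, the vanishing exponents form a lattice, and \<open>torus\<close> is what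
  remains to be checked. The set \<open>U\<close> leaves room for an extra binomial.\<close>

lemma separating_radical:
  fixes \<rho> :: "int ^ 'm \<Rightarrow> 'k::field"
  assumes \<rho>: "partial_character L \<rho>" and sep: "separating \<rho> (-J) us" and U: "U \<subseteq> L"
    and torus: "\<And>Q. prime_ideal Q \<Longrightarrow> is_lattice {v \<in> L. lattice_binomial \<rho> v \<in> Q} \<Longrightarrow>
      lattice_span (set us \<union> U) \<subseteq> {v \<in> L. lattice_binomial \<rho> v \<in> Q} \<Longrightarrow> lattice_binomial \<rho> ` L \<subseteq> Q"
  shows "ideal_radical (lattice_ideal L \<rho>) = ideal_radical (ideal_of (lattice_binomial \<rho> ` (set us \<union> U)))"
  unfolding lattice_ideal_def
proof (rule ideal_radical_ideal_of_eq)
  have us: "set us \<subseteq> L" using sep by (simp add: separating_def section_compl)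
  then show "lattice_binomial \<rho> ` (set us \<union> U) \<subseteq> ideal_of (lattice_binomial \<rho> ` L)"
    using ideal_of_superset[of "lattice_binomial \<rho> ` L"] U by blast
  fix Q :: "('m, 'k) mpoly set"
  assume Q: "prime_ideal Q" and B: "lattice_binomial \<rho> ` (set us \<union> U) \<subseteq> Q"
  have iff: "var s \<in> Q \<longleftrightarrow> (\<exists>j\<in>J. var j \<in> Q)" if "s \<notin> J" for s
    using sep Q B that by (simp add: separating_def image_Un)
  show "lattice_binomial \<rho> ` L \<subseteq> Q"
  proof (cases "\<exists>j\<in>J. var j \<in> Q")
    case True
    then show ?thesis using boundary[OF \<rho> Q] iff by blast
  next
    case False
    then have lat: "is_lattice {v \<in> L. lattice_binomial \<rho> v \<in> Q}"
      using iff by (intro lattice_vanishing[OF \<rho> Q]) blast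
    then show ?thesis using us U B by (intro torus[OF Q] lattice_span_minimal) blast+
  qed
qed

text \<open>Since \<open>u\<^sub>0\<close> generates \<open>L\<close> modulo the span of
  \<open>us\<close>, its binomial is the only one to be added.\<close>

lemma ara_lattice_ideal_le_Suc:
  fixes \<rho> :: "int ^ 'm \<Rightarrow> 'k::field"
  assumes \<rho>: "partial_character L \<rho>"
  shows "ara (lattice_ideal L \<rho>) \<le> enat (Suc (card (-J)))"
proof -
  obtain us u\<^sub>0 where sep: "separating \<rho> (-J) us" and u0: "u\<^sub>0 \<in> L"
    and cyc: "\<forall>v\<in>L. \<exists>c. v - c *s u\<^sub>0 \<in> lattice_span (set us)"
    using separating_cyclic[OF \<rho> order_refl] unfolding section_compl by auto
  have us: "set us \<subseteq> L" using sep by (simp add: separating_def section_compl)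
  have "ideal_radical (lattice_ideal L \<rho>) =
      ideal_radical (ideal_of (lattice_binomial \<rho> ` (set us \<union> {u\<^sub>0})))"
  proof (rule separating_radical[OF \<rho> sep])
    fix Q :: "('m, 'k) mpoly set"
    let ?V = "{v \<in> L. lattice_binomial \<rho> v \<in> Q}"
    assume V: "is_lattice ?V" and span: "lattice_span (set us \<union> {u\<^sub>0}) \<subseteq> ?V"
    have "v \<in> ?V" if v: "v \<in> L" for v
    proof -
      obtain c where "v - c *s u\<^sub>0 \<in> lattice_span (set us)" using cyc v by blast
      then have "v - c *s u\<^sub>0 \<in> ?V"
        using span lattice_span_mono[of "set us" "set us \<union> {u\<^sub>0}"] by blast
      moreover have "c *s u\<^sub>0 \<in> ?V"
        using span lattice_span_superset[of "set us \<union> {u\<^sub>0}"] by (intro lattice_scale[OF V]) blast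
      ultimately have "(v - c *s u\<^sub>0) + c *s u\<^sub>0 \<in> ?V" by (rule lattice_add[OF V])
      then show ?thesis by simp
    qed
    then show "lattice_binomial \<rho> ` L \<subseteq> Q" by blast
  qed (use u0 in simp)
  moreover have "lattice_binomial \<rho> ` (set us \<union> {u\<^sub>0}) \<subseteq> lattice_ideal L \<rho>"
    using us u0 ideal_of_superset[of "lattice_binomial \<rho> ` L"] by (auto simp: lattice_ideal_def)
  moreover have "length us = card (-J)" using sep by (simp add: separating_def)
  ultimately show ?thesis
    by (intro ara_le[of "map (lattice_binomial \<rho>) (us @ [u\<^sub>0])"]) auto
qed

text \<open>A power of the characteristic maps \<open>L\<close> into the span of \<open>us\<close>.
  The binomial of the multiple of \<open>v\<close> is a power of the binomial of \<open>v\<close>,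
  and primes contain the base of each power that they contain.\<close>

lemma ara_lattice_ideal_le:
  fixes \<rho> :: "int ^ 'm \<Rightarrow> 'k::field"
  assumes \<rho>: "partial_character L \<rho>" and char: "0 < CHAR('k)"
  shows "ara (lattice_ideal L \<rho>) \<le> enat (card (-J))"
proof -
  let ?p = "CHAR('k)"
  have p: "prime ?p" using char by (rule prime_CHAR_semidom)
  obtain us e where sep: "separating \<rho> (-J) us"
    and e: "\<forall>v\<in>L. int ?p ^ e *s v \<in> lattice_span (set us)"
    using separating_prime_power[OF \<rho> prime_ge_2_nat[OF p] order_refl] unfolding section_compl by auto
  have us: "set us \<subseteq> L" using sep by (simp add: separating_def section_compl)
  have "ideal_radical (lattice_ideal L \<rho>) =
      ideal_radical (ideal_of (lattice_binomial \<rho> ` (set us \<union> {})))"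
  proof (rule separating_radical[OF \<rho> sep])
    fix Q :: "('m, 'k) mpoly set"
    let ?V = "{v \<in> L. lattice_binomial \<rho> v \<in> Q}"
    assume Q: "prime_ideal Q" and V: "is_lattice ?V" and span: "lattice_span (set us \<union> {}) \<subseteq> ?V"
    have "lattice_binomial \<rho> v \<in> Q" if v: "v \<in> L" for v
    proof -
      let ?q = "?p ^ e"
      have "int ?q *s v \<in> ?V" using e v span by auto
      moreover have "exponent_vec (\<Sum>i<?q. pos_part v) - exponent_vec (\<Sum>i<?q. neg_part v) = int ?q *s v"
        unfolding vec_eq_iff
        by (simp add: lookup_sum_const lookup_pos_part lookup_neg_part flip: right_diff_distrib)
      ultimately have "single (\<Sum>i<?q. pos_part v) 1 - single (\<Sum>i<?q. neg_part v) (\<rho> (int ?q *s v)) \<in> Q"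
        by (intro binomial_mem_ideal[OF prime_ideal_is_ideal[OF Q]]) blast+
      then have "lattice_binomial \<rho> v ^ ?q \<in> Q"
        by (simp only: lattice_binomial_power_char[OF \<rho> v char refl])
      then show ?thesis using Q p by (simp add: prime_ideal_power prime_gt_0_nat)
    qed
    then show "lattice_binomial \<rho> ` L \<subseteq> Q" by blast
  qed simp
  moreover have "lattice_binomial \<rho> ` set us \<subseteq> lattice_ideal L \<rho>"
    using us ideal_of_superset[of "lattice_binomial \<rho> ` L"] by (auto simp: lattice_ideal_def)
  moreover have "length us = card (-J)" using sep by (simp add: separating_def)
  ultimately show ?thesis
    by (intro ara_le[of "map (lattice_binomial \<rho>) us"]) auto
qed

end

section \<open>Lower bound for the height\<close>

lemma poly_mapping_times_eq_sum:
  fixes f g :: "'b::monoid_add \<Rightarrow>\<^sub>0 'a::semiring_0"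
  shows "f * g = (\<Sum>u\<in>keys f. \<Sum>v\<in>keys g. single (u + v) (lookup f u * lookup g v))"
proof -
  have "f * g = (\<Sum>u\<in>keys f. single u (lookup f u)) * (\<Sum>v\<in>keys g. single v (lookup g v))"
    by (simp only: poly_mapping_sum_singles)
  then show ?thesis by (simp add: sum_product mult_single)
qed

definition coefficient_ideal :: "'a::comm_ring_1 set \<Rightarrow> ('b::comm_monoid_add \<Rightarrow>\<^sub>0 'a) set"
  where "coefficient_ideal P = {F. \<forall>w. lookup F w \<in> P}"

text \<open>The argument of Gauss's lemma: let \<open>a\<close> and \<open>b\<close> be the largest
  exponents whose coefficients lie outside of \<open>P\<close>. All other products that contribute
  to the coefficient at \<open>a + b\<close> lie in \<open>P\<close>, so this coefficient does
  not.\<close>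

lemma prime_coefficient_ideal:
  fixes P :: "'a::comm_ring_1 set"
  assumes P: "prime_ideal P"
  shows "prime_ideal (coefficient_ideal P :: ('b::{linorder, ordered_cancel_comm_monoid_add} \<Rightarrow>\<^sub>0 'a) set)"
  unfolding prime_ideal_def
proof (intro conjI allI impI)
  let ?E = "coefficient_ideal P :: ('b \<Rightarrow>\<^sub>0 'a) set"
  note I = prime_ideal_is_ideal[OF P]
  have lookup_times: "lookup (f * g) w =
      (\<Sum>(u, v)\<in>keys f \<times> keys g. if u + v = w then lookup f u * lookup g v else 0)"
    for f g :: "'b \<Rightarrow>\<^sub>0 'a" and w
    by (subst poly_mapping_times_eq_sum)
      (simp add: lookup_sum lookup_single when_def flip: sum.cartesian_product)
  show "is_ideal ?E"
    unfolding is_ideal_iff coefficient_ideal_def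
    using I by (auto simp: ideal_zero lookup_add ideal_add lookup_times
        intro!: ideal_sum ideal_mult_left)
  show "?E \<noteq> UNIV"
  proof -
    have "lookup (1 :: 'b \<Rightarrow>\<^sub>0 'a) 0 \<notin> P" using prime_ideal_one[OF P] by simp
    then have "1 \<notin> ?E" unfolding coefficient_ideal_def by blast
    then show ?thesis by blast
  qed
  fix F G :: "'b \<Rightarrow>\<^sub>0 'a" assume FG: "F * G \<in> ?E"
  show "F \<in> ?E \<or> G \<in> ?E"
  proof (rule ccontr)
    assume not: "\<not> (F \<in> ?E \<or> G \<in> ?E)"
    define bad where "bad H = {u \<in> keys H. lookup H u \<notin> P}" for H :: "'b \<Rightarrow>\<^sub>0 'a"
    have bad_nonempty: "bad H \<noteq> {}" if "H \<notin> ?E" for H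
      using that ideal_zero[OF I] by (auto simp: bad_def coefficient_ideal_def in_keys_iff) metis
    have fin: "finite (bad H)" for H by (simp add: bad_def)
    define a where "a = Max (bad F)"
    define b where "b = Max (bad G)"
    have a: "a \<in> bad F" and b: "b \<in> bad G"
      using not bad_nonempty fin by (auto simp: a_def b_def intro!: Max_in)
    have above: "lookup F u \<in> P" if "a < u" for u
      using that Max_ge[OF fin, of u F] ideal_zero[OF I] not_le
      by (fastforce simp: a_def bad_def in_keys_iff)
    have above': "lookup G u \<in> P" if "b < u" for u
      using that Max_ge[OF fin, of u G] ideal_zero[OF I] not_le
      by (fastforce simp: b_def bad_def in_keys_iff)
    let ?h = "\<lambda>(u, v). if u + v = a + b then lookup F u * lookup G v else 0"
    let ?K = "keys F \<times> keys G"
    have ab: "(a, b) \<in> ?K" using a b by (simp add: bad_def)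
    have "lookup (F * G) (a + b) = sum ?h ?K" by (rule lookup_times)
    also have "\<dots> = ?h (a, b) + sum ?h (?K - {(a, b)})"
      using ab by (intro sum.remove) auto
    finally have "?h (a, b) = lookup (F * G) (a + b) - sum ?h (?K - {(a, b)})" by (simp only: add_diff_cancel_right')
    moreover have "sum ?h (?K - {(a, b)}) \<in> P"
    proof (intro ideal_sum[OF I])
      fix x assume "x \<in> ?K - {(a, b)}"
      then obtain u v where x: "x = (u, v)" "(u, v) \<noteq> (a, b)" by (cases x) auto
      \<comment> \<open>A pair other than \<open>(a, b)\<close> with the same sum exceeds
        \<open>a\<close> or \<open>b\<close> in one component.\<close>
      have "lookup F u \<in> P \<or> lookup G v \<in> P" if eq: "u + v = a + b"
      proof (cases u a rule: linorder_cases)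
        case less
        then have "b < v" using eq add_less_le_mono[of u a v b] by (cases "v \<le> b") auto
        then show ?thesis using above' by blast
      qed (use above eq x in auto)
      then show "?h x \<in> P" using x I by (auto simp: ideal_zero ideal_mult_left ideal_mult_right)
    qed
    moreover have "lookup (F * G) (a + b) \<in> P" using FG by (simp add: coefficient_ideal_def)
    ultimately have "?h (a, b) \<in> P" by (simp only: ideal_diff[OF I])
    then show False using a b by (simp add: bad_def prime_ideal_mult[OF P])
  qed
qed

section \<open>Separating the variables of a set from the others\<close>

definition restrict_exponent :: "'m set \<Rightarrow> ('m::finite \<Rightarrow>\<^sub>0 nat) \<Rightarrow> 'm \<Rightarrow>\<^sub>0 nat"
  where "restrict_exponent W u = (\<Sum>i\<in>W. single i (lookup u i))"

lemma lookup_restrict_exponent: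
  "lookup (restrict_exponent W u) i = (if i \<in> W then lookup u i else 0)"
  by (simp add: restrict_exponent_def lookup_sum lookup_single when_def)

lemma restrict_exponent_add:
  "restrict_exponent W (u + v) = restrict_exponent W u + restrict_exponent W v"
  by (simp add: restrict_exponent_def lookup_add single_add sum.distrib)

lemma restrict_exponent_id: "keys u \<subseteq> W \<Longrightarrow> restrict_exponent W u = u"
  by (rule poly_mapping_eqI) (auto simp: lookup_restrict_exponent in_keys_iff)

lemma restrict_exponent_zero: "keys u \<inter> W = {} \<Longrightarrow> restrict_exponent W u = 0"
  by (rule poly_mapping_eqI) (auto simp: lookup_restrict_exponent in_keys_iff)

lemma keys_restrict_exponent: "keys (restrict_exponent W u) = keys u \<inter> W"
  by (auto simp: in_keys_iff lookup_restrict_exponent split: if_splits)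

text \<open>The identification of K[x] with the polynomials in the variables outside of
  \<open>W\<close> over the ring in the variables of \<open>W\<close>. The coefficients are kept in
  the full ring, where membership in \<open>P\<close> can be tested.\<close>

definition separate_vars ::
    "'m set \<Rightarrow> ('m::finite, 'k::field) mpoly \<Rightarrow> ('m \<Rightarrow>\<^sub>0 nat) \<Rightarrow>\<^sub>0 ('m, 'k) mpoly"
  where "separate_vars W f =
    (\<Sum>u\<in>keys f. single (restrict_exponent (-W) u) (single (restrict_exponent W u) (lookup f u)))"

lemma separate_vars_add: "separate_vars W (f + g) = separate_vars W f + separate_vars W g"
  unfolding separate_vars_def
  by (rule sum_keys_add[of "\<lambda>u c. single (restrict_exponent (-W) u) (single (restrict_exponent W u) c)"])
    (simp_all add: single_add)

lemma separate_vars_0: "separate_vars W 0 = 0"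
  by (simp add: separate_vars_def)

lemma separate_vars_sum: "separate_vars W (sum f A) = (\<Sum>i\<in>A. separate_vars W (f i))"
  by (induction A rule: infinite_finite_induct) (auto simp: separate_vars_0 separate_vars_add)

lemma separate_vars_single:
  "separate_vars W (single u c) = single (restrict_exponent (-W) u) (single (restrict_exponent W u) c)"
  by (simp add: separate_vars_def)

lemma separate_vars_1: "separate_vars W 1 = 1"
  using separate_vars_single[of W 0 1] by (simp add: restrict_exponent_zero)

lemma separate_vars_times: "separate_vars W (f * g) = separate_vars W f * separate_vars W g"
proof -
  have "separate_vars W (f * g) = (\<Sum>u\<in>keys f. \<Sum>v\<in>keys g.
      single (restrict_exponent (-W) u) (single (restrict_exponent W u) (lookup f u)) *
      single (restrict_exponent (-W) v) (single (restrict_exponent W v) (lookup g v)))"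
    by (subst poly_mapping_times_eq_sum)
      (simp add: separate_vars_sum separate_vars_single mult_single restrict_exponent_add)
  then show ?thesis by (simp add: separate_vars_def sum_product)
qed

lemma separate_vars_in_vars:
  assumes "\<And>u. u \<in> keys f \<Longrightarrow> keys u \<subseteq> W"
  shows "separate_vars W f = single 0 f"
proof -
  have "separate_vars W f = (\<Sum>u\<in>keys f. single 0 (single u (lookup f u)))"
    unfolding separate_vars_def
  proof (intro sum.cong refl)
    fix u assume "u \<in> keys f"
    then have "restrict_exponent (-W) u = 0" "restrict_exponent W u = u"
      using assms[of u] by (auto intro!: restrict_exponent_zero restrict_exponent_id)
    then show "single (restrict_exponent (-W) u) (single (restrict_exponent W u) (lookup f u)) =
        single 0 (single u (lookup f u))" by simp
  qed
  also have "\<dots> = single 0 (\<Sum>u\<in>keys f. single u (lookup f u))"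
    by (rule poly_mapping_eqI) (simp add: lookup_sum lookup_single when_def)
  finally show ?thesis by (simp add: poly_mapping_sum_singles)
qed

lemma lookup_separate_vars:
  "lookup (separate_vars W f) w =
    (\<Sum>u\<in>keys f. if restrict_exponent (-W) u = w then single (restrict_exponent W u) (lookup f u) else 0)"
  by (simp add: separate_vars_def lookup_sum lookup_single when_def)

text \<open>Monomials in \<open>W' - W\<close> move from the exponents to the coefficients. So an
  ideal that contains all coefficients for \<open>W\<close> also contains those for
  \<open>W'\<close>.\<close>

lemma lookup_separate_vars_mono:
  assumes "W \<subseteq> W'"
  shows "lookup (separate_vars W' f) w' = (\<Sum>w\<in>restrict_exponent (-W) ` keys f.
    if restrict_exponent (-W') w = w'
    then single (restrict_exponent W' w) 1 * lookup (separate_vars W f) w else 0)"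
    (is "_ = (\<Sum>w\<in>?A. ?g w)")
proof -
  let ?r = "restrict_exponent (-W)"
  let ?h = "\<lambda>w u. if restrict_exponent (-W') w = w'
    then single (restrict_exponent W' w + restrict_exponent W u) (lookup f u) else 0"
  have comp: "restrict_exponent (-W') (?r u) = restrict_exponent (-W') u"
    "restrict_exponent W' (?r u) + restrict_exponent W u = restrict_exponent W' u" for u
    using assms by (auto intro!: poly_mapping_eqI simp: lookup_restrict_exponent lookup_add)
  have "(\<Sum>w\<in>?A. ?g w) = (\<Sum>w\<in>?A. \<Sum>u\<in>keys f. if ?r u = w then ?h w u else 0)"
  proof (intro sum.cong refl)
    fix w
    show "?g w = (\<Sum>u\<in>keys f. if ?r u = w then ?h w u else 0)"
    proof (cases "restrict_exponent (-W') w = w'")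
      case True
      then show ?thesis
        by (auto simp: lookup_separate_vars sum_distrib_left mult_single intro!: sum.cong)
    next
      case False
      then show ?thesis by (simp add: if_distrib cong: if_cong)
    qed
  qed
  also have "\<dots> = (\<Sum>u\<in>keys f. \<Sum>w\<in>?A. if ?r u = w then ?h w u else 0)" by (rule sum.swap)
  also have "\<dots> = (\<Sum>u\<in>keys f. ?h (?r u) u)" by (intro sum.cong refl) simp
  also have "\<dots> = (\<Sum>u\<in>keys f. if restrict_exponent (-W') u = w'
      then single (restrict_exponent W' u) (lookup f u) else 0)"
    by (simp only: comp)
  finally show ?thesis by (simp add: lookup_separate_vars)
qed

text \<open>The extension to the whole polynomial ring of the contraction of \<open>P\<close> to \<open>K[x\<^sub>i | i \<in> W]\<close>.\<close>

definition contract_extend ::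
    "'m set \<Rightarrow> ('m::finite, 'k::field) mpoly set \<Rightarrow> ('m, 'k) mpoly set"
  where "contract_extend W P = {f. separate_vars W f \<in> coefficient_ideal P}"

lemma prime_contract_extend:
  fixes P :: "('m::{finite, linorder}, 'k::field) mpoly set"
  assumes P: "prime_ideal P"
  shows "prime_ideal (contract_extend W P)"
proof -
  have E: "prime_ideal (coefficient_ideal P :: (('m \<Rightarrow>\<^sub>0 nat) \<Rightarrow>\<^sub>0 ('m, 'k) mpoly) set)"
    by (rule prime_coefficient_ideal[OF P])
  note I = prime_ideal_is_ideal[OF E]
  have "1 \<notin> contract_extend W P"
    using prime_ideal_one[OF E] by (simp add: contract_extend_def separate_vars_1)
  then have "contract_extend W P \<noteq> UNIV" by blast
  moreover have "is_ideal (contract_extend W P)"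
    unfolding is_ideal_iff using I
    by (simp add: contract_extend_def separate_vars_0 separate_vars_add separate_vars_times
        ideal_zero ideal_add ideal_mult_left)
  ultimately show ?thesis
    unfolding prime_ideal_def using E
    by (simp add: contract_extend_def separate_vars_times prime_ideal_mult)
qed

lemma contract_extend_mono:
  assumes "is_ideal P" "W \<subseteq> W'"
  shows "contract_extend W P \<subseteq> contract_extend W' P"
  using assms
  by (auto simp: contract_extend_def coefficient_ideal_def lookup_separate_vars_mono
      intro!: ideal_sum ideal_zero ideal_mult_left)

lemma contract_extend_in_vars:
  assumes "is_ideal P" "\<And>u. u \<in> keys f \<Longrightarrow> keys u \<subseteq> W"
  shows "f \<in> contract_extend W P \<longleftrightarrow> f \<in> P"
  using ideal_zero[OF assms(1)]
  by (auto simp: contract_extend_def separate_vars_in_vars[OF assms(2)] coefficient_ideal_def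
      lookup_single when_def)

lemma contract_extend_UNIV: "is_ideal P \<Longrightarrow> contract_extend UNIV P = P"
  using contract_extend_in_vars[of P _ UNIV] by blast

text \<open>Before \<open>k\<close> is added, \<open>var k\<close> has the coefficient 1, which lies
  in no prime; afterwards it is its own coefficient.\<close>

lemma contract_extend_insert_var:
  assumes P: "prime_ideal P" and k: "var k \<in> P" "k \<notin> W"
  shows "contract_extend W P \<subset> contract_extend (insert k W) P"
proof -
  have "var k \<in> contract_extend (insert k W) P"
    using k by (subst contract_extend_in_vars) (auto simp: prime_ideal_is_ideal[OF P] var_def)
  moreover have "var k \<notin> contract_extend W P"
  proof
    assume "var k \<in> contract_extend W P"
    then have "lookup (separate_vars W (var k)) (single k 1) \<in> P"
      by (simp add: contract_extend_def coefficient_ideal_def)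
    moreover have "restrict_exponent (-W) (single k 1) = single k (1 :: nat)"
      "restrict_exponent W (single k 1) = (0 :: _ \<Rightarrow>\<^sub>0 nat)"
      using k by (auto intro!: restrict_exponent_id restrict_exponent_zero)
    ultimately show False
      using prime_ideal_one[OF P] by (simp add: var_def separate_vars_single)
  qed
  ultimately show ?thesis
    using contract_extend_mono[of P W "insert k W"] prime_ideal_is_ideal[OF P] by blast
qed

section \<open>Growth of the contractions with the rank\<close>

definition supported_in :: "'m set \<Rightarrow> (int ^ 'm) set \<Rightarrow> (int ^ 'm) set"
  where "supported_in W L = {u \<in> L. \<forall>i. i \<notin> W \<longrightarrow> u $ i = 0}"

text \<open>The binomial of a vector with nonzero entry at \<open>k\<close>, read as a polynomial in
  x_k, has as leading coefficient a monomial in the variables of \<open>W\<close>, which is outside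
  of \<open>P\<close>.\<close>

lemma contract_extend_insert_lattice:
  fixes \<rho> :: "int ^ 'm::{finite, linorder} \<Rightarrow> 'k::field"
  assumes \<rho>: "partial_character L \<rho>" and P: "prime_ideal P" "lattice_ideal L \<rho> \<subseteq> P"
    and k: "k \<notin> W" and W: "\<And>i. i \<in> W \<Longrightarrow> var i \<notin> P"
    and u: "u \<in> supported_in (insert k W) L" "u $ k \<noteq> 0"
  shows "contract_extend W P \<subset> contract_extend (insert k W) P"
proof -
  \<comment> \<open>The sign is chosen so that x_k occurs in the positive part, whose coefficient is
    1.\<close>
  define v where "v = (if 0 < u $ k then u else - u)"
  have v: "v \<in> L" "0 < v $ k" and v0: "\<And>i. i \<notin> insert k W \<Longrightarrow> v $ i = 0"
    using u lattice_uminus[OF partial_character_lattice[OF \<rho>]]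
    by (auto simp: v_def supported_in_def)
  let ?b = "lattice_binomial \<rho> v"
  have keys_v: "keys (pos_part v) \<subseteq> insert k W" "keys (neg_part v) \<subseteq> W"
    using v v0 by (auto simp: in_keys_iff lookup_pos_part lookup_neg_part) force+
  have "?b \<in> contract_extend (insert k W) P"
  proof (subst contract_extend_in_vars[OF prime_ideal_is_ideal[OF P(1)]])
    show "?b \<in> P"
      using v(1) P(2) ideal_of_superset[of "lattice_binomial \<rho> ` L"] by (auto simp: lattice_ideal_def)
    fix x assume "x \<in> keys ?b"
    then have "x = pos_part v \<or> x = neg_part v"
      by (auto simp: lattice_binomial_def in_keys_iff lookup_minus lookup_single when_def split: if_splits)
    then show "keys x \<subseteq> insert k W" using keys_v by blast
  qed
  moreover have "?b \<notin> contract_extend W P"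
  proof
    assume "?b \<in> contract_extend W P"
    \<comment> \<open>The exponent of the leading term in the variables outside of \<open>W\<close>.
      The negative part has exponent 0 there, so the two terms cannot interfere.\<close>
    let ?w = "restrict_exponent (-W) (pos_part v)"
    have "?b + single (neg_part v) (\<rho> v) = single (pos_part v) 1" by (simp add: lattice_binomial_def)
    then have "separate_vars W ?b + separate_vars W (single (neg_part v) (\<rho> v)) =
        separate_vars W (single (pos_part v) 1)"
      by (simp only: flip: separate_vars_add)
    moreover have "restrict_exponent (-W) (neg_part v) = 0"
      using keys_v by (intro restrict_exponent_zero) blast
    moreover have "lookup ?w k \<noteq> 0" using v k by (simp add: lookup_restrict_exponent lookup_pos_part)
    then have "?w \<noteq> 0" by auto
    ultimately have "lookup (separate_vars W ?b) ?w + 0 = single (restrict_exponent W (pos_part v)) 1"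
      unfolding separate_vars_single
      by (metis (no_types) lookup_add lookup_single_eq lookup_single_not_eq)
    then have "single (restrict_exponent W (pos_part v)) 1 \<in> P"
      using \<open>?b \<in> contract_extend W P\<close> by (auto simp: contract_extend_def coefficient_ideal_def dest: spec[of _ ?w])
    then show False
      using W by (auto simp: single_mem_prime_iff[OF P(1)] keys_restrict_exponent)
  qed
  ultimately show ?thesis
    using contract_extend_mono[of P W "insert k W"] prime_ideal_is_ideal[OF P(1)] by blast
qed

text \<open>The combination \<open>u $ k *s v - v $ k *s u\<close> has entry 0 at \<open>k\<close>,
  so the larger section is spanned over \<rat> by the smaller one and a single vector
  \<open>u\<close>.\<close>

lemma rank_insert:
  fixes L :: "(int ^ 'm::finite) set"
  assumes "is_lattice L"
  defines "d \<equiv> \<lambda>W. lattice_rank (supported_in W L)"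
  shows "d (insert k W) \<le> d W \<or>
    d (insert k W) = Suc (d W) \<and> (\<exists>u\<in>supported_in (insert k W) L. u $ k \<noteq> 0)"
proof (cases "\<exists>u\<in>supported_in (insert k W) L. u $ k \<noteq> 0")
  case False
  then have "supported_in (insert k W) L = supported_in W L" by (auto simp: supported_in_def)
  then show ?thesis by (simp add: d_def)
next
  case True
  then obtain u where u: "u \<in> supported_in (insert k W) L" "u $ k \<noteq> 0" by blast
  have "rat_vec ` supported_in (insert k W) L \<subseteq>
      vec.span (insert (rat_vec u) (rat_vec ` supported_in W L))"
  proof
    fix x assume "x \<in> rat_vec ` supported_in (insert k W) L"
    then obtain v where v: "v \<in> supported_in (insert k W) L" "x = rat_vec v" by blast
    let ?r = "u $ k *s v - v $ k *s u"
    have r: "?r \<in> supported_in W L"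
    proof -
      have "?r \<in> L" using u v assms(1) by (auto simp: supported_in_def intro!: lattice_diff lattice_scale)
      moreover have "?r $ i = 0" if "i \<notin> W" for i
        using u v that by (cases "i = k") (auto simp: supported_in_def mult.commute)
      ultimately show ?thesis by (simp add: supported_in_def)
    qed
    have "x = (1 / of_int (u $ k)) *s rat_vec ?r + (of_int (v $ k) / of_int (u $ k)) *s rat_vec u"
      using u(2) by (simp add: v(2) rat_vec_def vec_eq_iff field_simps)
    also have "\<dots> \<in> vec.span (insert (rat_vec u) (rat_vec ` supported_in W L))"
      using r by (intro vec.span_add vec.span_scale vec.span_base) auto
    finally show "x \<in> vec.span (insert (rat_vec u) (rat_vec ` supported_in W L))" .
  qed
  then have "d (insert k W) \<le> vec.dim (insert (rat_vec u) (rat_vec ` supported_in W L))"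
    unfolding d_def lattice_rank_def by (metis vec.dim_span vec.dim_subset)
  also have "\<dots> \<le> Suc (d W)" by (simp add: vec.dim_insert d_def lattice_rank_def)
  finally show ?thesis using True by (auto simp: le_Suc_eq)
qed

text \<open>Where the rank grows, the contraction grows strictly as well: by
  \<open>contract_extend_insert_var\<close> if \<open>var k\<close> is in \<open>P\<close>, and
  otherwise by \<open>contract_extend_insert_lattice\<close>.\<close>

lemma prime_chain_contract_extend_insert:
  fixes \<rho> :: "int ^ 'm::{finite, linorder} \<Rightarrow> 'k::field"
  assumes \<rho>: "partial_character L \<rho>" and P: "prime_ideal P" "lattice_ideal L \<rho> \<subseteq> P"
    and k: "k \<notin> W" and W: "var k \<in> P \<or> (\<forall>i\<in>W. var i \<notin> P)"
    and chain: "prime_chain (lattice_rank (supported_in W L)) (contract_extend W P)"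
  shows "prime_chain (lattice_rank (supported_in (insert k W) L)) (contract_extend (insert k W) P)"
proof -
  let ?d = "\<lambda>W. lattice_rank (supported_in W L)"
  have prime: "prime_ideal (contract_extend (insert k W) P)" by (rule prime_contract_extend[OF P(1)])
  have rank: "?d (insert k W) \<le> ?d W \<or>
    ?d (insert k W) = Suc (?d W) \<and> (\<exists>u\<in>supported_in (insert k W) L. u $ k \<noteq> 0)"
    by (rule rank_insert[OF partial_character_lattice[OF \<rho>]])
  show ?thesis
  proof (cases "contract_extend W P = contract_extend (insert k W) P")
    case True
    then have "?d (insert k W) \<le> ?d W"
      using rank W contract_extend_insert_var[OF P(1) _ k]
        contract_extend_insert_lattice[OF \<rho> P k] by blast
    then show ?thesis using prime_chain_mono[OF chain] True by simp
  next
    case False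
    then have "contract_extend W P \<subset> contract_extend (insert k W) P"
      using contract_extend_mono[OF prime_ideal_is_ideal[OF P(1)], of W "insert k W"] by blast
    then have "prime_chain (Suc (?d W)) (contract_extend (insert k W) P)"
      using chain prime unfolding prime_chain_Suc by blast
    then show ?thesis using rank by (elim prime_chain_mono) linarith
  qed
qed

text \<open>The variables outside of \<open>P\<close> have to be added first, so that the binomials of \<open>L\<close> in these
  variables have leading coefficients outside of \<open>P\<close>.\<close>

lemma lattice_rank_le_height:
  fixes \<rho> :: "int ^ 'm::{finite, linorder} \<Rightarrow> 'k::field"
  assumes \<rho>: "partial_character L \<rho>"
  shows "enat (lattice_rank L) \<le> ideal_height (lattice_ideal L \<rho>)"
proof (rule le_ideal_height)
  fix P :: "('m, 'k) mpoly set"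
  assume P: "prime_ideal P" "lattice_ideal L \<rho> \<subseteq> P"
  let ?C = "\<lambda>W. prime_chain (lattice_rank (supported_in W L)) (contract_extend W P)"
  let ?V = "{i. var i \<notin> P}"
  have "?C W" if "W \<subseteq> ?V" for W
    using finite[of W] that
  proof (induction W rule: finite_induct)
    case empty
    have "supported_in {} L = {0}"
      using lattice_zero[OF partial_character_lattice[OF \<rho>]] by (auto simp: supported_in_def vec_eq_iff)
    then have "lattice_rank (supported_in {} L) = 0"
      by (simp add: lattice_rank_def rat_vec_def zero_vec_def[symmetric])
    then show ?case by (simp add: prime_chain_0 prime_contract_extend[OF P(1)])
  next
    case (insert k W)
    then show ?case by (intro prime_chain_contract_extend_insert[OF \<rho> P]) auto
  qed
  then have V: "?C ?V" by blast
  have "?C (?V \<union> Z)" if "Z \<subseteq> -?V" for Z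
    using finite[of Z] that
  proof (induction Z rule: finite_induct)
    case empty
    then show ?case using V by simp
  next
    case (insert k Z)
    have "?C (insert k (?V \<union> Z))"
      using insert by (intro prime_chain_contract_extend_insert[OF \<rho> P]) auto
    then show ?case by simp
  qed
  from this[of "-?V"] show "prime_chain (lattice_rank L) P"
    by (simp add: contract_extend_UNIV prime_ideal_is_ideal[OF P(1)] supported_in_def)
qed

section \<open>Upper bound for the height\<close>

text \<open>The size of a box is known exactly, and boxes are comparable with bounds on the total
  degree from both sides.\<close>

definition box_exponents :: "'m set \<Rightarrow> nat \<Rightarrow> ('m \<Rightarrow>\<^sub>0 nat) set"
  where "box_exponents W q = {u. keys u \<subseteq> W \<and> (\<forall>i\<in>W. lookup u i < q)}"

lemma card_box_exponents:
  fixes W :: "'m::finite set"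
  shows "finite (box_exponents W q)" "card (box_exponents W q) = q ^ card W"
proof -
  let ?F = "W \<rightarrow>\<^sub>E {..<q}"
  let ?h = "\<lambda>u. restrict (lookup u) W"
  have "bij_betw ?h (box_exponents W q) ?F"
  proof (rule bij_betw_imageI)
    show "inj_on ?h (box_exponents W q)"
    proof (rule inj_onI, rule poly_mapping_eqI)
      fix u v i assume u: "u \<in> box_exponents W q" and v: "v \<in> box_exponents W q" and eq: "?h u = ?h v"
      show "lookup u i = lookup v i"
      proof (cases "i \<in> W")
        case True
        then show ?thesis using fun_cong[OF eq, of i] by simp
      next
        case False
        then have "i \<notin> keys u" "i \<notin> keys v" using u v by (auto simp: box_exponents_def)
        then show ?thesis by (simp add: in_keys_iff)
      qed
    qed
    show "?h ` box_exponents W q = ?F"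
    proof
      show "?h ` box_exponents W q \<subseteq> ?F" by (auto simp: box_exponents_def)
      show "?F \<subseteq> ?h ` box_exponents W q"
      proof
        fix g assume g: "g \<in> ?F"
        let ?u = "\<Sum>i\<in>W. single i (g i)"
        have l: "lookup ?u i = (if i \<in> W then g i else 0)" for i
          by (simp add: lookup_sum lookup_single when_def)
        have "?u \<in> box_exponents W q"
          unfolding box_exponents_def mem_Collect_eq
        proof (intro conjI ballI subsetI)
          show "i \<in> W" if "i \<in> keys ?u" for i using that l[of i] by (simp add: in_keys_iff split: if_splits)
          show "lookup ?u i < q" if "i \<in> W" for i using that PiE_mem[OF g that] l[of i] by simp
        qed
        moreover have "?h ?u = g"
        proof
          fix i
          show "?h ?u i = g i" using PiE_arb[OF g, of i] by (simp add: l)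
        qed
        ultimately show "g \<in> ?h ` box_exponents W q" by (intro image_eqI[of g ?h ?u]) simp_all
      qed
    qed
  qed
  moreover have "finite ?F" "card ?F = q ^ card W" by (simp_all add: card_PiE finite_PiE)
  ultimately show "finite (box_exponents W q)" "card (box_exponents W q) = q ^ card W"
    using bij_betw_finite bij_betw_same_card by fastforce+
qed

section \<open>Degrees and Hilbert functions\<close>

definition total_degree :: "('m::finite \<Rightarrow>\<^sub>0 nat) \<Rightarrow> nat"
  where "total_degree u = (\<Sum>i\<in>UNIV. lookup u i)"

lemma total_degree_add: "total_degree (u + v) = total_degree u + total_degree v"
  by (simp add: total_degree_def lookup_add sum.distrib)

lemma lookup_le_total_degree: "lookup u i \<le> total_degree u"
  unfolding total_degree_def by (rule member_le_sum) auto

lemma total_degree_box: "u \<in> box_exponents W q \<Longrightarrow> total_degree u \<le> card W * q"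
proof -
  assume u: "u \<in> box_exponents W q"
  have "total_degree u = (\<Sum>i\<in>W. lookup u i)"
    using u unfolding total_degree_def
    by (intro sum.mono_neutral_right) (auto simp: box_exponents_def in_keys_iff)
  also have "\<dots> \<le> (\<Sum>i\<in>W. q)"
    using u by (intro sum_mono) (auto simp: box_exponents_def order_less_imp_le)
  finally show ?thesis by simp
qed

lemma degree_le_subset_box: "{u. total_degree u \<le> d} \<subseteq> box_exponents UNIV (Suc d)"
  using lookup_le_total_degree by (fastforce simp: box_exponents_def less_Suc_eq_le intro: order_trans)

lemma finite_degree_le: "finite {u :: 'm::finite \<Rightarrow>\<^sub>0 nat. total_degree u \<le> d}"
  using degree_le_subset_box card_box_exponents(1) by (rule finite_subset)

lemma card_degree_le: "card {u :: 'm::finite \<Rightarrow>\<^sub>0 nat. total_degree u \<le> d} \<le> Suc d ^ CARD('m)"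
  using card_mono[OF card_box_exponents(1) degree_le_subset_box, of d]
  by (simp add: card_box_exponents(2))

interpretation mpoly_space: vector_space "\<lambda>c (f :: ('m, 'k::field) mpoly). single 0 c * f"
  by standard (simp_all add: algebra_simps single_add mult_single flip: mult.assoc)

definition degree_bounded :: "nat \<Rightarrow> ('m::finite, 'k::field) mpoly set"
  where "degree_bounded d = {f. \<forall>u\<in>keys f. total_degree u \<le> d}"

lemma degree_bounded_mono: "d \<le> e \<Longrightarrow> degree_bounded d \<subseteq> degree_bounded e"
  by (auto simp: degree_bounded_def)

lemma degree_bounded_times:
  assumes "f \<in> degree_bounded d" "g \<in> degree_bounded e"
  shows "f * g \<in> degree_bounded (d + e)"
  using assms Poly_Mapping.keys_mult[of f g]
  by (force simp: degree_bounded_def total_degree_add intro: add_mono)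

lemma degree_bounded_exists: "\<exists>d. f \<in> degree_bounded d"
  by (auto simp: degree_bounded_def intro!: exI[of _ "\<Sum>u\<in>keys f. total_degree u"] member_le_sum)

lemma degree_bounded_span:
  "degree_bounded d \<subseteq> mpoly_space.span ((\<lambda>u. single u 1) ` {u. total_degree u \<le> d})"
proof
  fix f :: "('m::finite, 'k::field) mpoly" assume f: "f \<in> degree_bounded d"
  have "f = (\<Sum>u\<in>keys f. single 0 (lookup f u) * single u 1)"
    by (simp add: mult_single poly_mapping_sum_singles)
  also have "\<dots> \<in> mpoly_space.span ((\<lambda>u. single u 1) ` {u. total_degree u \<le> d})"
    using f by (intro mpoly_space.span_sum mpoly_space.span_scale mpoly_space.span_base)
      (auto simp: degree_bounded_def)
  finally show "f \<in> mpoly_space.span ((\<lambda>u. single u 1) ` {u. total_degree u \<le> d})" .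
qed

text \<open>Linear independence of residue classes, expressed in K[x] itself; it also forces the
  classes of distinct elements of \<open>S\<close> to differ.\<close>

definition independent_mod :: "('m, 'k::field) mpoly set \<Rightarrow> ('m, 'k) mpoly set \<Rightarrow> bool"
  where "independent_mod P S \<longleftrightarrow> finite S \<and>
    (\<forall>a. (\<Sum>s\<in>S. single 0 (a s) * s) \<in> P \<longrightarrow> (\<forall>s\<in>S. a s = 0))"

text \<open>A lower bound for the Hilbert function of the affine algebra \<open>K[x]/P\<close>.\<close>

definition hilbert_ge :: "('m::finite, 'k::field) mpoly set \<Rightarrow> nat \<Rightarrow> nat \<Rightarrow> bool"
  where "hilbert_ge P d N \<longleftrightarrow> (\<exists>S. S \<subseteq> degree_bounded d \<and> independent_mod P S \<and> N \<le> card S)"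

lemma hilbert_ge_bound:
  fixes P :: "('m::finite, 'k::field) mpoly set"
  assumes "is_ideal P" "hilbert_ge P d N"
  shows "N \<le> Suc d ^ CARD('m)"
proof -
  obtain S where S: "S \<subseteq> degree_bounded d" "independent_mod P S" "N \<le> card S"
    using assms(2) unfolding hilbert_ge_def by blast
  have "\<not> mpoly_space.dependent S"
    using S(2) ideal_zero[OF assms(1)]
    by (auto simp: independent_mod_def mpoly_space.dependent_finite)
  then have "card S \<le> card ((\<lambda>u. single u 1 :: ('m, 'k) mpoly) ` {u. total_degree u \<le> d})"
    using S(1) degree_bounded_span
    by (intro conjunct2[OF mpoly_space.independent_span_bound] finite_imageI finite_degree_le) blast+
  also have "\<dots> \<le> card {u :: 'm \<Rightarrow>\<^sub>0 nat. total_degree u \<le> d}" by (intro card_image_le finite_degree_le)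
  also have "\<dots> \<le> Suc d ^ CARD('m)" by (rule card_degree_le)
  finally show ?thesis using S(3) by linarith
qed

text \<open>Multiplication by \<open>f\<close> is injective modulo \<open>P\<close> and has its
  image in \<open>P'\<close>. So for a relation modulo \<open>P\<close> on \<open>f S\<close> and
  \<open>S'\<close>, reduction modulo \<open>P'\<close> kills the coefficients of \<open>S'\<close>,
  and \<open>f\<close> can be cancelled from the rest.\<close>

lemma hilbert_ge_subprime:
  fixes P P' :: "('m::{finite, linorder}, 'k::field) mpoly set"
  assumes P: "prime_ideal P" and P': "is_ideal P'" and sub: "P \<subseteq> P'"
    and f: "f \<in> P'" "f \<notin> P" "f \<in> degree_bounded e"
    and "hilbert_ge P d N" "hilbert_ge P' (e + d) N'"
  shows "hilbert_ge P (e + d) (N + N')"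
proof -
  obtain S where S: "S \<subseteq> degree_bounded d" "independent_mod P S" "N \<le> card S"
    using assms unfolding hilbert_ge_def by blast
  obtain S' where S': "S' \<subseteq> degree_bounded (e + d)" "independent_mod P' S'" "N' \<le> card S'"
    using assms unfolding hilbert_ge_def by blast
  have fin: "finite S" "finite S'" using S(2) S'(2) by (simp_all add: independent_mod_def)
  have ind: "\<And>a s. (\<Sum>s\<in>S. single 0 (a s) * s) \<in> P \<Longrightarrow> s \<in> S \<Longrightarrow> a s = 0"
    and ind': "\<And>a s. (\<Sum>s\<in>S'. single 0 (a s) * s) \<in> P' \<Longrightarrow> s \<in> S' \<Longrightarrow> a s = 0"
    using S(2) S'(2) by (auto simp: independent_mod_def)
  let ?fS = "(*) f ` S"
  have "f \<noteq> 0" using f(2) ideal_zero[OF prime_ideal_is_ideal[OF P]] by blast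
  then have inj: "inj_on ((*) f) S" by (auto simp: inj_on_def)
  \<comment> \<open>A common element would lie in \<open>P'\<close>, contrary to the independence of
    \<open>S'\<close> modulo \<open>P'\<close>.\<close>
  have disj: "?fS \<inter> S' = {}"
  proof (rule ccontr)
    assume "?fS \<inter> S' \<noteq> {}"
    then obtain s where s: "f * s \<in> S'" by blast
    have "(\<Sum>t\<in>S'. single 0 (of_bool (t = f * s)) * t) = (\<Sum>t\<in>{f * s}. t)"
      using s fin by (intro sum.mono_neutral_cong_right) auto
    then have "of_bool (f * s = f * s) = (0 :: 'k)"
      using f(1) P' s by (intro ind'[of "\<lambda>t. of_bool (t = f * s)"]) (auto simp: ideal_mult_right)
    then show False by simp
  qed
  have "independent_mod P (?fS \<union> S')"
    unfolding independent_mod_def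
  proof (intro conjI allI impI)
    show "finite (?fS \<union> S')" using fin by simp
    fix a assume "(\<Sum>s\<in>?fS \<union> S'. single 0 (a s) * s) \<in> P"
    moreover have "(\<Sum>s\<in>?fS \<union> S'. single 0 (a s) * s) =
        f * (\<Sum>s\<in>S. single 0 (a (f * s)) * s) + (\<Sum>s\<in>S'. single 0 (a s) * s)"
      using fin disj inj
      by (simp add: sum.union_disjoint sum.reindex sum_distrib_left mult.left_commute)
    ultimately have sum: "f * (\<Sum>s\<in>S. single 0 (a (f * s)) * s) + (\<Sum>s\<in>S'. single 0 (a s) * s) \<in> P" by simp
    then have "(\<Sum>s\<in>S'. single 0 (a s) * s) \<in> P'"
      using sub ideal_add_iff[OF P' ideal_mult_right[OF P' f(1)]] by blast
    then have a': "a s = 0" if "s \<in> S'" for s using ind' that by blast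
    then have "f * (\<Sum>s\<in>S. single 0 (a (f * s)) * s) \<in> P" using sum by simp
    then have "(\<Sum>s\<in>S. single 0 (a (f * s)) * s) \<in> P" using f(2) by (simp add: prime_ideal_mult[OF P])
    then have "a (f * s) = 0" if "s \<in> S" for s using ind[of "\<lambda>s. a (f * s)"] that by blast
    then show "\<forall>s\<in>?fS \<union> S'. a s = 0" using a' by blast
  qed
  moreover have "?fS \<union> S' \<subseteq> degree_bounded (e + d)"
    using S(1) S'(1) degree_bounded_times[OF f(3)] by blast
  moreover have "N + N' \<le> card (?fS \<union> S')"
    using fin disj inj S(3) S'(3) by (simp add: card_Un_disjoint card_image)
  ultimately show ?thesis unfolding hilbert_ge_def by blast
qed

lemma hilbert_ge_mono: "hilbert_ge P d N \<Longrightarrow> d \<le> e \<Longrightarrow> M \<le> N \<Longrightarrow> hilbert_ge P e M"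
  unfolding hilbert_ge_def using degree_bounded_mono by (meson le_trans order_trans)

lemma hilbert_ge_0: "is_ideal P \<Longrightarrow> hilbert_ge P d 0"
  unfolding hilbert_ge_def by (auto simp: independent_mod_def intro!: exI[of _ "{}"])

text \<open>Polynomial growth of degree \<open>j\<close> for \<open>K[x]/P'\<close> forces growth of degree \<open>j + 1\<close> for \<open>K[x]/P\<close>;
  binomial coefficients turn this into Pascal's rule.\<close>

lemma hilbert_ge_choose_Suc:
  fixes P P' :: "('m::{finite, linorder}, 'k::field) mpoly set"
  assumes P: "prime_ideal P" and P': "is_ideal P'" and sub: "P \<subset> P'"
    and growth: "\<And>q. hilbert_ge P' (e * q) (q choose j)"
  shows "\<exists>e. \<forall>q. hilbert_ge P (e * q) (q choose Suc j)"
proof -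
  obtain f where f: "f \<in> P'" "f \<notin> P" using sub by blast
  obtain d where d: "f \<in> degree_bounded d" using degree_bounded_exists by blast
  \<comment> \<open>Each unit of \<open>q\<close> has to pay for the degree of \<open>f\<close> and
    for the growth modulo \<open>P'\<close>.\<close>
  define c where "c = d + e"
  have "hilbert_ge P (c * q) (q choose Suc j)" for q
  proof (induction q)
    case 0
    then show ?case by (simp add: hilbert_ge_0 prime_ideal_is_ideal[OF P])
  next
    case (Suc q)
    have "hilbert_ge P' (c + c * q) (Suc q choose j)"
      by (rule hilbert_ge_mono[OF growth[of "Suc q"]]) (simp_all add: c_def algebra_simps)
    then have "hilbert_ge P (c + c * q) ((q choose Suc j) + (Suc q choose j))"
      using f sub degree_bounded_mono[of d c] d
      by (intro hilbert_ge_subprime[OF P P' _ f(1,2) _ Suc]) (auto simp: c_def)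
    \<comment> \<open>Pascal's rule asks only for the smaller of these two binomial
      coefficients.\<close>
    moreover have "q choose j \<le> Suc q choose j" by (cases j) simp_all
    ultimately show ?case by (elim hilbert_ge_mono) (simp_all)
  qed
  then show ?thesis by blast
qed

text \<open>The chain is descended from the top; the witness \<open>P'\<close> is its smallest
  prime.\<close>

lemma hilbert_ge_choose_chain:
  fixes P :: "('m::{finite, linorder}, 'k::field) mpoly set"
  assumes "prime_chain k P" "\<And>q. hilbert_ge P (e * q) (q choose j)"
  shows "\<exists>P' e. is_ideal P' \<and> (\<forall>q. hilbert_ge (P' :: ('m, 'k) mpoly set) (e * q) (q choose (j + k)))"
  using assms
proof (induction k arbitrary: P e j)
  case 0
  have "is_ideal P" using "0.prems"(1) by (intro prime_ideal_is_ideal prime_chain_prime)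
  then show ?case using "0.prems"(2) by (intro exI[of _ P] exI[of _ e]) simp
next
  case (Suc k)
  obtain P' where P': "P' \<subset> P" "prime_chain k P'" and P: "prime_ideal P"
    using Suc.prems(1) unfolding prime_chain_Suc by blast
  obtain e' where "\<And>q. hilbert_ge P' (e' * q) (q choose Suc j)"
    using hilbert_ge_choose_Suc[OF prime_chain_prime[OF P'(2)] prime_ideal_is_ideal[OF P] P'(1) Suc.prems(2)]
    by blast
  from Suc.IH[OF P'(2) this] show ?case by simp
qed

text \<open>At \<open>q = j * t\<close> the binomial coefficient is at least \<open>t ^ j\<close>,
  which outgrows a polynomial of degree \<open>m\<close> in \<open>t\<close> if \<open>j\<close>
  exceeds \<open>m\<close>.\<close>

lemma choose_growth:
  assumes "\<And>q. q choose j \<le> Suc (e * q) ^ m"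
  shows "j \<le> m"
proof (rule ccontr)
  assume "\<not> j \<le> m"
  then have j: "Suc m \<le> j" by simp
  \<comment> \<open>The constant factor of \<open>t ^ m\<close> in the upper bound; \<open>t\<close>
    is taken just above it.\<close>
  define c where "c = (e * j + 1) ^ m"
  define t where "t = Suc c"
  have "t ^ m * t \<le> t ^ j"
    using power_increasing[OF j, of t] by (simp add: t_def mult.commute)
  also have "t ^ j \<le> (j * t) choose j"
  proof -
    have "j \<le> j * t" by (simp add: t_def)
    then have "(real (j * t) / real j) ^ j \<le> real ((j * t) choose j)"
      by (rule binomial_ge_n_over_k_pow_k)
    then have "real t ^ j \<le> real ((j * t) choose j)" using j by simp
    then show ?thesis by (metis of_nat_le_iff of_nat_power)
  qed
  also have "\<dots> \<le> Suc (e * (j * t)) ^ m" by (rule assms)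
  also have "\<dots> \<le> ((e * j + 1) * t) ^ m" by (intro power_mono) (simp_all add: t_def algebra_simps)
  also have "\<dots> = t ^ m * c" by (simp only: c_def power_mult_distrib mult.commute)
  finally have "t \<le> c" by (simp add: t_def)
  then show False by (simp add: t_def)
qed

text \<open>The monomials in the variables of \<open>W\<close> are independent modulo
  \<open>P\<close>, so the Hilbert function starts with growth of order \<open>card W\<close>. The
  chain adds \<open>l\<close> to the order, and the growth cannot exceed that of all
  polynomials.\<close>

lemma prime_chain_bound:
  fixes P :: "('m::{finite, linorder}, 'k::field) mpoly set"
  assumes chain: "prime_chain l P"
    and alg_indep: "\<And>f. f \<in> P \<Longrightarrow> (\<And>u. u \<in> keys f \<Longrightarrow> keys u \<subseteq> W) \<Longrightarrow> f = 0"
  shows "card W + l \<le> CARD('m)"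
proof -
  have "hilbert_ge P (card W * q) (q choose card W)" for q
  proof -
    let ?X = "\<lambda>u. single u 1 :: ('m, 'k) mpoly"
    let ?B = "box_exponents W q"
    have inj: "inj_on ?X ?B" by (auto simp: inj_on_def dest: arg_cong[of _ _ keys])
    have "independent_mod P (?X ` ?B)"
      unfolding independent_mod_def
    proof (intro conjI allI impI ballI)
      show "finite (?X ` ?B)" by (simp add: card_box_exponents(1))
      fix a s assume mem: "(\<Sum>s\<in>?X ` ?B. single 0 (a s) * s) \<in> P" and "s \<in> ?X ` ?B"
      then obtain u where u: "u \<in> ?B" "s = ?X u" by blast
      let ?f = "\<Sum>u\<in>?B. single u (a (?X u))"
      have lookup_f: "lookup ?f v = (if v \<in> ?B then a (?X v) else 0)" for v
        using card_box_exponents(1)[of W q] by (simp add: lookup_sum lookup_single when_def)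
      have "?f \<in> P" using mem inj by (simp add: sum.reindex mult_single)
      moreover have "keys v \<subseteq> W" if "v \<in> keys ?f" for v
      proof -
        have "v \<in> ?B" using that lookup_f[of v] by (simp add: in_keys_iff split: if_splits)
        then show ?thesis by (simp add: box_exponents_def)
      qed
      ultimately have "?f = 0" by (rule alg_indep)
      then show "a s = 0" using lookup_f[of u] u by simp
    qed
    moreover have "?X ` ?B \<subseteq> degree_bounded (card W * q)"
      using total_degree_box[of _ W q] by (auto simp: degree_bounded_def)
    moreover have "q choose card W \<le> card (?X ` ?B)"
      using inj by (cases "card W \<le> q") (simp_all add: card_image card_box_exponents(2) binomial_le_pow binomial_eq_0)
    ultimately show ?thesis unfolding hilbert_ge_def by blast
  qed
  from hilbert_ge_choose_chain[OF chain this] obtain P' :: "('m, 'k) mpoly set" and e where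
    "is_ideal P'" "\<And>q. hilbert_ge P' (e * q) (q choose (card W + l))" by blast
  then have "q choose (card W + l) \<le> Suc (e * q) ^ CARD('m)" for q by (rule hilbert_ge_bound)
  then show ?thesis by (rule choose_growth)
qed

text \<open>The nonzero polynomials in the variables of \<open>W\<close> are closed under products
  and avoid \<open>I\<close>, so some prime over \<open>I\<close> avoids them too.\<close>

lemma ideal_height_le_card:
  fixes I :: "('m::{finite, linorder}, 'k::field) mpoly set"
  assumes I: "is_ideal I"
    and alg_indep: "\<And>f. f \<in> I \<Longrightarrow> (\<And>u. u \<in> keys f \<Longrightarrow> keys u \<subseteq> W) \<Longrightarrow> f = 0"
  shows "ideal_height I \<le> enat (card (-W))"
proof -
  let ?M = "{f :: ('m, 'k) mpoly. f \<noteq> 0 \<and> (\<forall>u\<in>keys f. keys u \<subseteq> W)}"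
  obtain P where P: "prime_ideal P" "I \<subseteq> P" "P \<inter> ?M = {}"
  proof (rule prime_ideal_avoiding[OF I, of ?M])
    show "1 \<in> ?M" by simp
    show "I \<inter> ?M = {}" using alg_indep by blast
    fix f g assume f: "f \<in> ?M" and g: "g \<in> ?M"
    have "keys u \<subseteq> W" if u: "u \<in> keys (f * g)" for u
    proof -
      obtain a b where "u = a + b" "a \<in> keys f" "b \<in> keys g"
        using u Poly_Mapping.keys_mult[of f g] by blast
      then show ?thesis using f g Poly_Mapping.keys_add[of a b] by blast
    qed
    then show "f * g \<in> ?M" using f g by simp
  qed
  show ?thesis
  proof (rule ideal_height_le[OF P(1,2)])
    fix l assume "prime_chain l P"
    then have "card W + l \<le> CARD('m)" using P(3) by (intro prime_chain_bound) auto
    then show "l \<le> card (-W)" by (simp add: Compl_eq_Diff_UNIV card_Diff_subset)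
  qed
qed

text \<open>The linear functional that sends x^u to \<rho>(u - w) if \<open>u\<close> lies in the
  coset of \<open>w\<close> modulo \<open>L\<close>, and to 0 otherwise.\<close>

definition coset_sum ::
    "(int ^ 'm) set \<Rightarrow> (int ^ 'm \<Rightarrow> 'k::field) \<Rightarrow> int ^ 'm \<Rightarrow> ('m, 'k) mpoly \<Rightarrow> 'k"
  where "coset_sum L \<rho> w f =
    (\<Sum>u\<in>keys f. if exponent_vec u - w \<in> L then lookup f u * \<rho> (exponent_vec u - w) else 0)"

lemma coset_sum_add: "coset_sum L \<rho> w (f + g) = coset_sum L \<rho> w f + coset_sum L \<rho> w g"
  unfolding coset_sum_def
  by (rule sum_keys_add[of "\<lambda>u c. if exponent_vec u - w \<in> L then c * \<rho> (exponent_vec u - w) else 0"])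
    (simp_all add: distrib_right)

lemma coset_sum_0: "coset_sum L \<rho> w 0 = 0"
  by (simp add: coset_sum_def)

lemma coset_sum_single:
  "coset_sum L \<rho> w (single u c) = (if exponent_vec u - w \<in> L then c * \<rho> (exponent_vec u - w) else 0)"
  by (simp add: coset_sum_def)

lemma coset_sum_single_times:
  "coset_sum L \<rho> w (single t a * f) = a * coset_sum L \<rho> (w - exponent_vec t) f"
proof (induction f rule: poly_mapping_add_induct)
  case (single u c)
  have "exponent_vec (t + u) - w = exponent_vec u - (w - exponent_vec t)"
    by (simp add: exponent_vec_add)
  then show ?case by (simp only: mult_single coset_sum_single) simp
qed (simp_all add: coset_sum_0 coset_sum_add distrib_left)

text \<open>Multiplication by a monomial only shifts the coset, so the common kernel of these
  functionals is an ideal. On a binomial the two contributions cancel, since \<rho> is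
  multiplicative.\<close>

lemma coset_sum_lattice_ideal:
  fixes \<rho> :: "int ^ 'm::finite \<Rightarrow> 'k::field"
  assumes \<rho>: "partial_character L \<rho>" and f: "f \<in> lattice_ideal L \<rho>"
  shows "coset_sum L \<rho> w f = 0"
proof -
  note L = partial_character_lattice[OF \<rho>]
  let ?I = "{f. \<forall>w. coset_sum L \<rho> w f = 0}"
  have "coset_sum L \<rho> w (c * x) = 0" if "x \<in> ?I" for c x w
    by (induction c rule: poly_mapping_add_induct)
      (use that in \<open>simp_all add: coset_sum_0 coset_sum_add coset_sum_single_times distrib_right\<close>)
  then have "is_ideal ?I" by (auto simp: is_ideal_iff coset_sum_0 coset_sum_add)
  moreover have "lattice_binomial \<rho> ` L \<subseteq> ?I"
  proof clarify
    fix v w assume v: "v \<in> L"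
    let ?p = "exponent_vec (pos_part v) - w" and ?n = "exponent_vec (neg_part v) - w"
    have pn: "?p = v + ?n" using exponent_vec_pos_neg[of v] by (simp add: algebra_simps)
    have iff: "?p \<in> L \<longleftrightarrow> ?n \<in> L"
      using lattice_add[OF L v, of ?n] lattice_diff[OF L _ v, of ?p] by (auto simp: pn)
    have "lattice_binomial \<rho> v = single (pos_part v) 1 + single (neg_part v) (- \<rho> v)"
      by (simp add: lattice_binomial_def single_uminus)
    then have "coset_sum L \<rho> w (lattice_binomial \<rho> v) =
        (if ?p \<in> L then \<rho> ?p else 0) - (if ?n \<in> L then \<rho> v * \<rho> ?n else 0)"
      by (simp add: coset_sum_add coset_sum_single)
    also have "\<dots> = 0" using iff partial_character_add[OF \<rho> v, of ?n] by (simp add: pn)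
    finally show "coset_sum L \<rho> w (lattice_binomial \<rho> v) = 0" .
  qed
  ultimately show ?thesis using f by (auto simp: lattice_ideal_def dest: ideal_of_subset_iff)
qed

text \<open>Exponents supported in \<open>W\<close> are congruent modulo \<open>L\<close> only if
  they are equal. So the functional at an exponent of \<open>f\<close> returns its coefficient,
  although it vanishes on the lattice ideal.\<close>

lemma ideal_height_lattice_ideal_le:
  fixes \<rho> :: "int ^ 'm::{finite, linorder} \<Rightarrow> 'k::field"
  assumes \<rho>: "partial_character L \<rho>" and indep: "supported_in W L = {0}"
  shows "ideal_height (lattice_ideal L \<rho>) \<le> enat (card (-W))"
proof (rule ideal_height_le_card)
  show "is_ideal (lattice_ideal L \<rho>)" by (simp add: lattice_ideal_def is_ideal_ideal_of)
  fix f assume f: "f \<in> lattice_ideal L \<rho>" and keys: "\<And>u. u \<in> keys f \<Longrightarrow> keys u \<subseteq> W"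
  show "f = 0"
  proof (rule ccontr)
    assume "f \<noteq> 0"
    then obtain u where u: "u \<in> keys f" by (metis ex_in_conv keys_eq_empty)
    have same: "v = u" if v: "v \<in> keys f" and L: "exponent_vec v - exponent_vec u \<in> L" for v
    proof -
      have "lookup v i = 0 \<and> lookup u i = 0" if "i \<notin> W" for i
        using keys[OF v] keys[OF u] that by (auto simp: in_keys_iff)
      then have "exponent_vec v - exponent_vec u \<in> supported_in W L"
        using L by (simp add: supported_in_def)
      then have "exponent_vec v = exponent_vec u" by (simp add: indep)
      then show ?thesis by (auto intro!: poly_mapping_eqI simp: vec_eq_iff)
    qed
    have "coset_sum L \<rho> (exponent_vec u) f =
        (\<Sum>v\<in>{u}. lookup f v * \<rho> (exponent_vec v - exponent_vec u))"
      unfolding coset_sum_def using u same lattice_zero[OF partial_character_lattice[OF \<rho>]]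
      by (intro sum.mono_neutral_cong_right) auto
    then have "lookup f u = 0"
      using coset_sum_lattice_ideal[OF \<rho> f] by (simp add: partial_character_zero[OF \<rho>])
    then show False using u by (simp add: in_keys_iff)
  qed
qed

section \<open>Lower bound for the arithmetical rank\<close>

text \<open>The \<open>k\<close>-th power of the maximal ideal of the origin.\<close>

definition order_ge :: "nat \<Rightarrow> ('m::finite, 'k::field) mpoly set"
  where "order_ge k = {f. \<forall>u\<in>keys f. k \<le> total_degree u}"

lemma order_ge_add: "f \<in> order_ge k \<Longrightarrow> g \<in> order_ge k \<Longrightarrow> f + g \<in> order_ge k"
  using Poly_Mapping.keys_add[of f g] by (auto simp: order_ge_def)

lemma order_ge_sum: "(\<And>i. i \<in> A \<Longrightarrow> f i \<in> order_ge k) \<Longrightarrow> sum f A \<in> order_ge k"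
  by (induction A rule: infinite_finite_induct) (auto simp: order_ge_add, auto simp: order_ge_def)

lemma order_ge_times: "f \<in> order_ge k \<Longrightarrow> g \<in> order_ge l \<Longrightarrow> f * g \<in> order_ge (k + l)"
  using Poly_Mapping.keys_mult[of f g] by (force simp: order_ge_def total_degree_add intro: add_mono)

lemma order_ge_1:
  assumes "lookup f 0 = 0"
  shows "f \<in> order_ge 1"
  unfolding order_ge_def
proof clarify
  fix u assume u: "u \<in> keys f"
  show "1 \<le> total_degree u"
  proof (rule ccontr)
    assume "\<not> 1 \<le> total_degree u"
    then have "lookup u i = 0" for i using lookup_le_total_degree[of u i] by simp
    then have "u = 0" by (auto intro: poly_mapping_eqI)
    then show False using u assms by (simp add: in_keys_iff)
  qed
qed

text \<open>The representative modulo \<open>order_ge k\<close> that has only terms of degree less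
  than \<open>k\<close>.\<close>

definition truncate_degree :: "nat \<Rightarrow> ('m::finite, 'k::field) mpoly \<Rightarrow> ('m, 'k) mpoly"
  where "truncate_degree k f = (\<Sum>u\<in>keys f. if total_degree u < k then single u (lookup f u) else 0)"

lemma truncate_add: "truncate_degree k (f + g) = truncate_degree k f + truncate_degree k g"
  unfolding truncate_degree_def
  by (rule sum_keys_add[of "\<lambda>u c. if total_degree u < k then single u c else 0"])
    (simp_all add: single_add)

lemma truncate_single: "truncate_degree k (single u c) = (if total_degree u < k then single u c else 0)"
  by (simp add: truncate_degree_def)

lemma truncate_0: "truncate_degree k 0 = 0"
  by (simp add: truncate_degree_def)

lemma truncate_scale: "truncate_degree k (single 0 c * f) = single 0 c * truncate_degree k f"
  by (induction f rule: poly_mapping_add_induct)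
    (simp_all add: truncate_0 truncate_add truncate_single mult_single distrib_left)

lemma truncate_order_ge: "f \<in> order_ge k \<Longrightarrow> truncate_degree k f = 0"
  by (auto simp: truncate_degree_def order_ge_def not_less intro!: sum.neutral)

lemma truncate_span:
  assumes "f \<in> mpoly_space.span G"
  shows "truncate_degree k f \<in> mpoly_space.span (truncate_degree k ` G)"
proof -
  have "mpoly_space.subspace {f. truncate_degree k f \<in> mpoly_space.span (truncate_degree k ` G)}"
    by (auto simp: mpoly_space.subspace_def truncate_0 truncate_add truncate_scale
        intro: mpoly_space.span_zero mpoly_space.span_add mpoly_space.span_scale)
  then show ?thesis
    using mpoly_space.span_minimal[of G "{f. truncate_degree k f \<in> mpoly_space.span (truncate_degree k ` G)}"] assms
    by (auto intro: mpoly_space.span_base)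
qed

lemma independent_monomials:
  assumes "finite B"
  shows "\<not> mpoly_space.dependent ((\<lambda>u. single u 1 :: ('m, 'k::field) mpoly) ` B)"
proof -
  let ?X = "\<lambda>u. single u 1 :: ('m, 'k) mpoly"
  have inj: "inj_on ?X B" by (auto simp: inj_on_def dest: arg_cong[of _ _ keys])
  have "a (?X u) = 0" if sum: "(\<Sum>s\<in>?X ` B. single 0 (a s) * s) = 0" and u: "u \<in> B" for a u
  proof -
    have "(\<Sum>v\<in>B. single v (a (?X v))) = 0" using sum inj by (simp add: sum.reindex mult_single)
    then have "lookup (\<Sum>v\<in>B. single v (a (?X v))) u = 0" by simp
    then show ?thesis using u assms by (simp add: lookup_sum lookup_single when_def)
  qed
  then show ?thesis using assms by (subst mpoly_space.dependent_finite) auto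
qed

text \<open>Modulo the \<open>k\<close>-th power of the maximal ideal of the origin, the polynomials \<open>x\<^sup>a g\<^sup>b\<close> with \<open>b\<^sub>j < k\<close>
  and \<open>x\<^sup>a\<close> among the finitely many monomials outside of \<open>(g)\<close> span everything; so the number of
  elements of \<open>g\<close> is at least the growth order of the number of monomials of degree less than \<open>k\<close>.\<close>

lemma card_le_length_parameters:
  fixes gs :: "('m::finite, 'k::field) mpoly list"
  assumes gs0: "\<And>g. g \<in> set gs \<Longrightarrow> lookup g 0 = 0"
    and vars: "\<And>i. var i \<in> ideal_radical (ideal_of (set gs))"
  shows "CARD('m) \<le> length gs"
proof -
  let ?I = "ideal_of (set gs)"
  let ?m = "CARD('m)"
  define t where "t = length gs"
  note I = is_ideal_ideal_of[of "set gs"]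
  obtain N where N: "\<And>i. var i ^ N i \<in> ?I" using vars unfolding ideal_radical_def by simp metis
  \<comment> \<open>A common exponent for all variables.\<close>
  define D where "D = (\<Sum>i\<in>UNIV. N i)"
  have D: "var i ^ D \<in> ?I" for i
  proof -
    have "N i \<le> D" unfolding D_def by (rule member_le_sum) auto
    then have "(var i :: ('m, 'k) mpoly) ^ D = var i ^ N i * var i ^ (D - N i)"
      by (simp flip: power_add)
    then show ?thesis using N ideal_mult_right[OF I] by metis
  qed
  let ?B = "box_exponents UNIV D :: ('m \<Rightarrow>\<^sub>0 nat) set"
  \<comment> \<open>Outside of the box some exponent reaches \<open>D\<close>, so the monomial is a
    multiple of an element of the ideal.\<close>
  have high: "single u c \<in> ?I" if u: "u \<notin> ?B" for u c
  proof -
    obtain i where i: "D \<le> lookup u i" using u by (auto simp: box_exponents_def not_less)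
    have "u = (u - single i D) + single i D"
      using i by (intro poly_mapping_eqI) (auto simp: lookup_add minus_poly_mapping.rep_eq lookup_single when_def)
    then have "single u c = single (u - single i D) c * var i ^ D"
      by (metis mult.right_neutral mult_single var_power)
    then show ?thesis using ideal_mult_left[OF I D] by simp
  qed
  define G where "G k = (\<lambda>(a, b). single a 1 * (\<Prod>j<t. gs ! j ^ b j)) ` (?B \<times> ({..<t} \<rightarrow>\<^sub>E {..<k}))" for k
  have finG: "finite (G k)" and cardG: "card (G k) \<le> D ^ ?m * k ^ t" for k
  proof -
    have fin: "finite (?B \<times> ({..<t} \<rightarrow>\<^sub>E {..<k}))"
      by (intro finite_cartesian_product card_box_exponents(1) finite_PiE) auto
    then show "finite (G k)" unfolding G_def by (rule finite_imageI)
    have "card (G k) \<le> card (?B \<times> ({..<t} \<rightarrow>\<^sub>E {..<k}))" unfolding G_def by (rule card_image_le[OF fin])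
    then show "card (G k) \<le> D ^ ?m * k ^ t"
      by (simp add: card_cartesian_product card_box_exponents(2) card_PiE)
  qed
  \<comment> \<open>Multiplication by \<open>gs ! i\<close> raises the exponent \<open>b i\<close>
    by 1.\<close>
  have G_mult: "x * gs ! i \<in> mpoly_space.span (G (Suc k))"
    if x: "x \<in> mpoly_space.span (G k)" and i: "i < t" for x i k
  proof -
    have "x * gs ! i \<in> G (Suc k)" if x': "x \<in> G k" for x
    proof -
      obtain a b where ab: "a \<in> ?B" "b \<in> {..<t} \<rightarrow>\<^sub>E {..<k}"
        "x = single a 1 * (\<Prod>j<t. gs ! j ^ b j)" using x' by (auto simp: G_def)
      let ?b = "b(i := Suc (b i))"
      have "?b \<in> {..<t} \<rightarrow>\<^sub>E {..<Suc k}"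
        using ab(2) i by (auto simp: PiE_iff extensional_def intro: less_SucI)
      moreover have "(\<Prod>j<t. gs ! j ^ ?b j) = (\<Prod>j<t. gs ! j ^ b j) * gs ! i"
      proof -
        have "(\<Prod>j<t. gs ! j ^ ?b j) = (\<Prod>j<t. gs ! j ^ b j * (if j = i then gs ! i else 1))"
          by (intro prod.cong) auto
        then show ?thesis using i by (simp add: prod.distrib)
      qed
      ultimately show ?thesis
        using ab(1,3) unfolding G_def by (intro image_eqI[of _ _ "(a, ?b)"]) (simp_all add: mult.assoc)
    qed
    then have "G k \<subseteq> {x. x * gs ! i \<in> mpoly_space.span (G (Suc k))}"
      by (auto intro: mpoly_space.span_base)
    moreover have "mpoly_space.subspace {x. x * gs ! i \<in> mpoly_space.span (G (Suc k))}"
      by (auto simp: mpoly_space.subspace_def distrib_right mult.assoc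
          intro: mpoly_space.span_zero mpoly_space.span_add mpoly_space.span_scale)
    ultimately show ?thesis using mpoly_space.span_minimal x by blast
  qed
  \<comment> \<open>Modulo monomials in the box, \<open>f\<close> is a combination of
    \<open>gs\<close> with coefficients \<open>q i\<close>, which are approximated by induction.
    Since the elements of \<open>gs\<close> have order at least 1, the error gains one
    order.\<close>
  have spans: "\<exists>h\<in>mpoly_space.span (G k). f - h \<in> order_ge k" for f k
  proof (induction k arbitrary: f)
    case 0
    show ?case by (intro bexI[of _ 0] mpoly_space.span_zero) (simp add: order_ge_def)
  next
    case (Suc k)
    define low where "low = (\<Sum>u\<in>keys f \<inter> ?B. single u (lookup f u))"
    have "f = (\<Sum>u\<in>keys f. single u (lookup f u))" by (simp add: poly_mapping_sum_singles)
    also have "\<dots> = low + (\<Sum>u\<in>keys f - ?B. single u (lookup f u))"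
      unfolding low_def by (rule sum.Int_Diff) simp
    finally have "f - low = (\<Sum>u\<in>keys f - ?B. single u (lookup f u))" by (simp add: algebra_simps)
    also have "\<dots> \<in> ?I" by (intro ideal_sum[OF I] high) auto
    finally obtain q where q: "f - low = (\<Sum>i<t. q i * gs ! i)"
      using ideal_of_list_sum unfolding t_def by blast
    obtain h where h: "\<And>i. h i \<in> mpoly_space.span (G k)" "\<And>i. q i - h i \<in> order_ge k"
      using Suc.IH[of "q _"] by metis
    have "low \<in> mpoly_space.span (G (Suc k))"
      unfolding low_def
    proof (intro mpoly_space.span_sum)
      fix u assume u: "u \<in> keys f \<inter> ?B"
      have "(\<lambda>j\<in>{..<t}. 0 :: nat) \<in> {..<t} \<rightarrow>\<^sub>E {..<Suc k}" by auto
      then have "single u 1 \<in> G (Suc k)"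
        using u unfolding G_def by (intro image_eqI[of _ _ "(u, \<lambda>j\<in>{..<t}. 0)"]) auto
      then have "single 0 (lookup f u) * single u 1 \<in> mpoly_space.span (G (Suc k))"
        by (intro mpoly_space.span_scale mpoly_space.span_base)
      then show "single u (lookup f u) \<in> mpoly_space.span (G (Suc k))" by (simp add: mult_single)
    qed
    moreover have "(\<Sum>i<t. h i * gs ! i) \<in> mpoly_space.span (G (Suc k))"
      using G_mult h(1) by (intro mpoly_space.span_sum) auto
    ultimately have "low + (\<Sum>i<t. h i * gs ! i) \<in> mpoly_space.span (G (Suc k))"
      by (rule mpoly_space.span_add)
    moreover have "f - (low + (\<Sum>i<t. h i * gs ! i)) = (\<Sum>i<t. (q i - h i) * gs ! i)"
      using q by (simp add: algebra_simps sum_subtractf)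
    moreover have "(q i - h i) * gs ! i \<in> order_ge (Suc k)" if "i < t" for i
      using order_ge_times[OF h(2) order_ge_1, of "gs ! i" i] gs0 that by (simp add: t_def)
    then have "(\<Sum>i<t. (q i - h i) * gs ! i) \<in> order_ge (Suc k)" by (intro order_ge_sum) auto
    ultimately show ?case by (intro bexI[of _ "low + (\<Sum>i<t. h i * gs ! i)"]) simp_all
  qed
  \<comment> \<open>Monomials of degree less than \<open>?k\<close> survive truncation, so they lie
    in the span of the truncated \<open>G ?k\<close>, and dimensions can be compared.\<close>
  have count: "q ^ ?m \<le> D ^ ?m * Suc (?m * q) ^ t" for q
  proof -
    let ?k = "Suc (?m * q)"
    let ?M = "(\<lambda>u. single u 1 :: ('m, 'k) mpoly) ` box_exponents UNIV q"
    have "?M \<subseteq> mpoly_space.span (truncate_degree ?k ` G ?k)"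
    proof clarify
      fix u :: "'m \<Rightarrow>\<^sub>0 nat" assume "u \<in> box_exponents UNIV q"
      then have u: "total_degree u < ?k" using total_degree_box by (simp add: less_Suc_eq_le)
      obtain h where h: "h \<in> mpoly_space.span (G ?k)" "single u 1 - h \<in> order_ge ?k"
        using spans by blast
      have "truncate_degree ?k (h + (single u 1 - h)) = truncate_degree ?k h"
        using truncate_order_ge[OF h(2)] by (simp only: truncate_add add_0_right)
      then have "single u 1 = truncate_degree ?k h" using u by (simp add: truncate_single)
      then show "single u 1 \<in> mpoly_space.span (truncate_degree ?k ` G ?k)" using truncate_span[OF h(1)] by simp
    qed
    moreover have "\<not> mpoly_space.dependent ?M" by (intro independent_monomials card_box_exponents(1))
    ultimately have "card ?M \<le> card (truncate_degree ?k ` G ?k)"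
      using finG by (intro conjunct2[OF mpoly_space.independent_span_bound]) auto
    also have "\<dots> \<le> card (G ?k)" by (rule card_image_le[OF finG])
    also have "\<dots> \<le> D ^ ?m * ?k ^ t" by (rule cardG)
    finally show ?thesis
      by (subst (asm) card_image) (auto simp: inj_on_def card_box_exponents(2) dest: arg_cong[of _ _ keys])
  qed
  show ?thesis
  proof (rule ccontr)
    assume "\<not> ?m \<le> length gs"
    then have t: "Suc t \<le> ?m" by (simp add: t_def)
    \<comment> \<open>With \<open>q\<close> just above this constant, the growth orders
      \<open>t + 1\<close> and \<open>t\<close> contradict each other.\<close>
    define C where "C = D ^ ?m * Suc ?m ^ t"
    define q where "q = Suc C"
    have "q ^ t * q \<le> q ^ ?m" using power_increasing[OF t, of q] by (simp add: q_def mult.commute)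
    also have "\<dots> \<le> D ^ ?m * Suc (?m * q) ^ t" by (rule count)
    also have "\<dots> \<le> D ^ ?m * (Suc ?m * q) ^ t" by (intro mult_left_mono power_mono) (simp_all add: q_def)
    also have "\<dots> = q ^ t * C" by (simp only: C_def power_mult_distrib ac_simps)
    finally have "q \<le> C" by (simp add: q_def)
    then show False by (simp add: q_def)
  qed
qed

lemma is_ideal_zero_constant_term: "is_ideal {f :: ('m, 'k::field) mpoly. lookup f 0 = 0}"
proof -
  have "lookup (c * x) 0 = 0" if x: "lookup x 0 = 0" for c x :: "('m, 'k) mpoly"
  proof -
    have "v = 0" if "u + v = 0" for u v :: "'m \<Rightarrow>\<^sub>0 nat"
      using that by (auto intro!: poly_mapping_eqI simp: lookup_add poly_mapping_eq_iff fun_eq_iff)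
    then have "lookup (single (u + v) (lookup c u * lookup x v)) 0 = 0" for u v
      using x by (auto simp: lookup_single when_def)
    then show ?thesis by (subst poly_mapping_times_eq_sum) (simp add: lookup_sum)
  qed
  then show ?thesis by (auto simp: is_ideal_iff lookup_add)
qed

context full_lattice
begin

text \<open>By \<open>nonneg_on_J\<close> for \<open>u\<close> and \<open>- u\<close>, a nonzero
  vector of \<open>L\<close> has entries of both signs, so neither monomial of its binomial is
  constant.\<close>

lemma constant_term_lattice_ideal:
  fixes \<rho> :: "int ^ 'm \<Rightarrow> 'k::field"
  assumes \<rho>: "partial_character L \<rho>" and J: "J \<noteq> {}" and f: "f \<in> lattice_ideal L \<rho>"
  shows "lookup f 0 = 0"
proof -
  have "lattice_binomial \<rho> ` L \<subseteq> {f. lookup f 0 = 0}"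
  proof clarify
    fix u assume u: "u \<in> L"
    show "lookup (lattice_binomial \<rho> u) 0 = 0"
    proof (cases "u = 0")
      case True
      then have "pos_part u = (0 :: 'm \<Rightarrow>\<^sub>0 nat)" "neg_part u = (0 :: 'm \<Rightarrow>\<^sub>0 nat)"
        by (simp_all add: pos_part_def neg_part_def)
      then show ?thesis using True by (simp add: lattice_binomial_def partial_character_zero[OF \<rho>] lookup_minus)
    next
      case False
      obtain k where k: "k \<in> J" using J by blast
      have ex: "\<exists>i. 0 < v $ i" if v: "v \<in> L" "v \<noteq> 0" for v
        using nonneg_on_J[OF v _ k] by (meson not_le)
      obtain i where "0 < u $ i" using ex[OF u False] by blast
      moreover obtain j where "0 < (- u) $ j"
        using ex[of "- u"] lattice_uminus[OF lattice_L u] False by auto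
      ultimately have "lookup (pos_part u) i \<noteq> 0" "lookup (neg_part u) j \<noteq> 0"
        by (simp_all add: lookup_pos_part lookup_neg_part)
      then have "pos_part u \<noteq> 0" "neg_part u \<noteq> 0" by auto
      then show ?thesis by (simp add: lattice_binomial_def lookup_minus lookup_single)
    qed
  qed
  then show ?thesis
    using f ideal_of_subset_iff[OF is_ideal_zero_constant_term] by (auto simp: lattice_ideal_def)
qed

text \<open>Together with the variables of \<open>J\<close> the polynomials cut out the origin: the
  binomial of \<open>w i\<close> is a power of x_i minus a multiple of a monomial in the variables
  of \<open>J\<close>. So \<open>card_le_length_parameters\<close> applies to the joint
  list.\<close>

lemma le_ara_lattice_ideal:
  fixes \<rho> :: "int ^ 'm \<Rightarrow> 'k::field"
  assumes \<rho>: "partial_character L \<rho>" and J: "J \<noteq> {}"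
  shows "enat (card (-J)) \<le> ara (lattice_ideal L \<rho>)"
proof (rule le_ara)
  let ?I = "lattice_ideal L \<rho>"
  fix fs assume fs: "set fs \<subseteq> ?I" and rad: "ideal_radical ?I = ideal_radical (ideal_of (set fs))"
  have I: "is_ideal ?I" by (simp add: lattice_ideal_def is_ideal_ideal_of)
  obtain js where js: "set js = J" "distinct js" using finite_distinct_list[of J] by auto
  let ?gs = "fs @ map var js"
  have "CARD('m) \<le> length ?gs"
  proof (rule card_le_length_parameters)
    fix g assume "g \<in> set ?gs"
    then show "lookup g 0 = 0"
      using fs constant_term_lattice_ideal[OF \<rho> J]
      by (auto simp: var_def lookup_single when_def poly_mapping_eq_iff fun_eq_iff)
  next
    fix i
    show "var i \<in> ideal_radical (ideal_of (set ?gs))"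
      unfolding ideal_radical_iff_primes[OF is_ideal_ideal_of]
    proof (intro allI impI)
      fix Q assume "prime_ideal Q \<and> ideal_of (set ?gs) \<subseteq> Q"
      then have Q: "prime_ideal Q" and sub: "set fs \<subseteq> Q" and vJ: "\<And>j. j \<in> J \<Longrightarrow> var j \<in> Q"
        using ideal_of_superset[of "set ?gs"] js(1) by auto
      have "?I \<subseteq> ideal_radical ?I" by (auto simp: ideal_radical_def intro: exI[of _ 1])
      then have IQ: "?I \<subseteq> Q"
        using Q sub unfolding rad
        by (auto simp: ideal_radical_iff_primes[OF is_ideal_ideal_of] ideal_of_subset_iff prime_ideal_is_ideal)
      show "var i \<in> Q"
      proof (cases "i \<in> J")
        case False
        note w = w_mem[OF False] w_diag[OF False] w_off[OF False] w_neg[OF False]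
        have pos: "keys (pos_part (w i)) = {i}"
        proof (rule Set.set_eqI)
          fix j
          show "j \<in> keys (pos_part (w i)) \<longleftrightarrow> j \<in> {i}"
            using w(2) w(3)[of j] w(4)[of j] N_pos by (cases "j = i"; cases "j \<in> J") (auto simp: in_keys_iff lookup_pos_part)
        qed
        obtain k where k: "k \<in> J" using J by blast
        have "k \<in> keys (neg_part (w i))" using w(4)[OF k] by (simp add: in_keys_iff lookup_neg_part)
        then have "single (neg_part (w i)) (\<rho> (w i)) \<in> Q"
          using vJ[OF k] by (subst single_mem_prime_iff[OF Q partial_character_nonzero[OF \<rho> w(1)]]) blast
        moreover have "lattice_binomial \<rho> (w i) \<in> Q"
          using IQ w(1) ideal_of_superset[of "lattice_binomial \<rho> ` L"] by (auto simp: lattice_ideal_def)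
        ultimately have "single (pos_part (w i)) 1 \<in> Q"
          unfolding lattice_binomial_def using ideal_diff_iff[OF prime_ideal_is_ideal[OF Q]] by blast
        then show ?thesis by (simp add: single_mem_prime_iff[OF Q] pos)
      qed (rule vJ)
    qed
  qed
  then have "CARD('m) \<le> length fs + card J" using js distinct_card[OF js(2)] by simp
  then show "card (-J) \<le> length fs" by (simp add: Compl_eq_Diff_UNIV card_Diff_subset)
qed

end

section \<open>Full configurations\<close>

text \<open>The number of smaller indices is strictly increasing in the index and hence enumerates
  the indices from 0.\<close>

lemma card_first_indices:
  assumes "k \<le> CARD('m::{finite, linorder})"
  shows "card (first_indices k :: 'm set) = k"
proof -
  let ?f = "\<lambda>i :: 'm. card {j. j < i}"
  have less: "?f i < ?f i'" if "i < i'" for i i'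
    using that by (intro psubset_card_mono) auto
  have inj: "inj ?f"
    using less by (intro injI) (metis linorder_cases less_irrefl)
  have "range ?f \<subseteq> {..<CARD('m)}" by (auto intro!: psubset_card_mono)
  then have range: "range ?f = {..<CARD('m)}"
    using inj by (intro card_subset_eq) (simp_all add: card_image)
  have "?f ` first_indices k = {..<k}"
  proof
    show "{..<k} \<subseteq> ?f ` first_indices k"
    proof
      fix l assume l: "l \<in> {..<k}"
      then have "l \<in> range ?f" using assms range by simp
      then show "l \<in> ?f ` first_indices k" using l by (auto simp: first_indices_def)
    qed
  qed (auto simp: first_indices_def)
  then show ?thesis using inj by (metis card_image card_lessThan inj_on_subset subset_UNIV)
qed

section \<open>The relations of the configuration and its cone\<close>

lemma lattice_saturation:
  assumes "is_lattice L"
  shows "is_lattice (saturation L)"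
  unfolding is_lattice_def
proof (intro conjI ballI)
  show "0 \<in> saturation L"
    using lattice_zero[OF assms] by (auto simp: saturation_def intro!: exI[of _ 1])
  fix u assume "u \<in> saturation L"
  then obtain d where d: "d \<noteq> 0" "d *s u \<in> L" by (auto simp: saturation_def)
  have "d *s (- u) = - (d *s u)" by (simp add: vec_eq_iff)
  then show "- u \<in> saturation L"
    using d lattice_uminus[OF assms d(2)] by (auto simp: saturation_def)
  fix v assume "v \<in> saturation L"
  then obtain e where e: "e \<noteq> 0" "e *s v \<in> L" by (auto simp: saturation_def)
  have "(d * e) *s (u + v) = e *s (d *s u) + d *s (e *s v)" by (simp add: vec_eq_iff algebra_simps)
  also have "\<dots> \<in> L" by (intro lattice_add lattice_scale assms d e)
  finally show "u + v \<in> saturation L"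
    using d e by (auto simp: saturation_def intro!: exI[of _ "d * e"])
qed

text \<open>The map \<open>\<psi>\<close> after the projection to the quotient is additive, hence
  \<int>-linear, and has kernel \<open>H\<close>; the sum is its value at \<open>v\<close>, expanded
  in unit vectors.\<close>

lemma configuration_relation:
  fixes \<psi> :: "(int ^ 'm::finite) set \<Rightarrow> int ^ 'n"
  assumes H: "is_lattice H" and \<psi>: "\<psi> \<in> iso (additive_group Mod H) additive_group"
  shows "v \<in> H \<longleftrightarrow> (\<Sum>i\<in>UNIV. v $ i *s \<psi> (H #>\<^bsub>additive_group\<^esub> axis i 1)) = 0"
proof -
  let ?G = "additive_group :: (int ^ 'm) monoid"
  interpret group ?G by (rule group_additive_group)
  have sub: "subgroup H ?G" using H by (simp add: subgroup_additive_group_iff)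
  have "comm_group ?G" by (rule group_comm_groupI) (simp add: additive_group_def add.commute)
  then interpret H: normal H ?G using sub by (rule comm_group.subgroup_imp_normal)
  have carrier: "carrier ?G = UNIV" by (simp add: additive_group_def)
  define \<phi> where "\<phi> v = \<psi> (H #>\<^bsub>?G\<^esub> v)" for v
  have coset: "H #>\<^bsub>?G\<^esub> v \<in> carrier (?G Mod H)" for v
    by (simp add: carrier_FactGroup carrier)
  have add: "\<phi> (u + v) = \<phi> u + \<phi> v" for u v
  proof -
    have "\<psi> ((H #>\<^bsub>?G\<^esub> u) \<otimes>\<^bsub>?G Mod H\<^esub> (H #>\<^bsub>?G\<^esub> v)) = \<phi> u \<otimes>\<^bsub>additive_group\<^esub> \<phi> v"
      unfolding \<phi>_def using \<psi> coset by (intro hom_mult) (auto simp: iso_def)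
    then show ?thesis
      unfolding \<phi>_def using H.rcos_sum[of u v] by (simp add: carrier) (simp add: additive_group_def)
  qed
  have zero: "\<phi> 0 = 0" using add[of 0 0] by simp
  have scale: "\<phi> (c *s u) = c *s \<phi> u" for c u
  proof (induction c rule: int_induct[of _ 0])
    case (step1 i)
    have eq: "(i + 1) *s u = i *s u + u" for u :: "int ^ 'b" by (simp add: vec_eq_iff algebra_simps)
    show ?case unfolding eq add step1 by simp
  next
    case (step2 i)
    have eq: "i *s u = (i - 1) *s u + u" for u :: "int ^ 'b" by (simp add: vec_eq_iff algebra_simps)
    have "\<phi> ((i - 1) *s u) + \<phi> u = \<phi> (i *s u)" by (simp only: eq[of u] add)
    also have "\<dots> = (i - 1) *s \<phi> u + \<phi> u" unfolding step2(2) by (rule eq)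
    finally show ?case by (rule add_right_imp_eq)
  qed (simp add: zero)
  have sum: "\<phi> (sum f A) = (\<Sum>i\<in>A. \<phi> (f i))" if "finite A" for f :: "'m \<Rightarrow> int ^ 'm" and A
    using that by (induction A rule: finite_induct) (simp_all add: zero add)
  have "\<phi> v = \<phi> (\<Sum>i\<in>UNIV. v $ i *s axis i 1)" by (simp add: basis_expansion)
  then have expand: "\<phi> v = (\<Sum>i\<in>UNIV. v $ i *s \<phi> (axis i 1))" by (simp add: sum scale)
  have "\<phi> v = 0 \<longleftrightarrow> H #>\<^bsub>?G\<^esub> v = H #>\<^bsub>?G\<^esub> 0"
  proof -
    have "inj_on \<psi> (carrier (?G Mod H))" using \<psi> by (simp add: iso_def bij_betw_def)
    then have "\<psi> (H #>\<^bsub>?G\<^esub> v) = \<psi> (H #>\<^bsub>?G\<^esub> 0) \<longleftrightarrow> H #>\<^bsub>?G\<^esub> v = H #>\<^bsub>?G\<^esub> 0"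
      using coset coset by (rule inj_on_eq_iff)
    then show ?thesis using zero by (simp add: \<phi>_def)
  qed
  also have "H #>\<^bsub>?G\<^esub> v = H #>\<^bsub>?G\<^esub> 0 \<longleftrightarrow> v \<in> H"
  proof -
    have "H #>\<^bsub>?G\<^esub> 0 = H"
      using lattice_zero[OF H] sub by (intro coset_join2) (simp_all add: carrier)
    moreover have "H #>\<^bsub>?G\<^esub> v = H \<longleftrightarrow> v \<in> H"
      using coset_join1[of H v] coset_join2[of v H] sub by (auto simp only: carrier UNIV_I subset_UNIV)
    ultimately show ?thesis by simp
  qed
  finally show ?thesis using expand by (simp add: \<phi>_def)
qed

text \<open>Faces are cut out by dot products, so a functional with prescribed values on
  \<open>B\<close> is represented by its values on the unit vectors.\<close>

lemma rat_linear_functional: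
  fixes B :: "(rat ^ 'n::finite) set"
  assumes "vec.independent B"
  shows "\<exists>c. \<forall>x\<in>B. rat_dot c x = f x"
proof -
  interpret pair: vector_space_pair "(*s) :: rat \<Rightarrow> rat ^ 'n \<Rightarrow> rat ^ 'n" "(*) :: rat \<Rightarrow> rat \<Rightarrow> rat"
    by unfold_locales (simp_all add: algebra_simps)
  obtain g where g: "Vector_Spaces.linear (*s) (*) g" "\<forall>x\<in>B. g x = f x"
    using pair.linear_independent_extend[OF assms] by blast
  interpret g: Vector_Spaces.linear "(*s) :: rat \<Rightarrow> rat ^ 'n \<Rightarrow> rat ^ 'n" "(*)" g by (rule g(1))
  have "rat_dot (\<chi> i. g (axis i 1)) x = g x" for x
  proof -
    have "g x = g (\<Sum>i\<in>UNIV. x $ i *s axis i 1)" by (simp add: basis_expansion)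
    then show ?thesis by (simp add: g.sum g.scale rat_dot_def mult.commute)
  qed
  then show ?thesis using g(2) by metis
qed

lemma rat_common_denominator:
  fixes c :: "'i \<Rightarrow> rat"
  assumes "finite A"
  shows "\<exists>d>0. \<exists>z. \<forall>i\<in>A. of_int d * c i = of_int (z i)"
  using assms
proof (induction A rule: finite_induct)
  case empty
  then show ?case by (intro exI[of _ 1]) auto
next
  case (insert i A)
  then obtain d z where d: "0 < d" "\<forall>j\<in>A. of_int d * c j = of_int (z j)" by blast
  obtain p q where pq: "quotient_of (c i) = (p, q)" by fastforce
  then have q: "0 < q" "c i = of_int p / of_int q"
    by (simp_all add: quotient_of_denom_pos quotient_of_div)
  have "of_int (d * q) * c j = of_int (if j = i then d * p else q * z j)" if "j \<in> insert i A" for j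
  proof (cases "j = i")
    case False
    then show ?thesis using d(2) that by (auto simp: ac_simps)
  qed (use q in simp)
  then show ?case using d(1) q(1)
    by (intro exI[of _ "d * q"] conjI exI[of _ "\<lambda>j. if j = i then d * p else q * z j"]) auto
qed

text \<open>The cone has dimension n and lies in the span of the n vectors at \<open>J\<close>, so
  these are distinct and independent.\<close>

lemma full_configuration_independent:
  fixes a :: "'m::{finite, linorder} \<Rightarrow> int ^ 'n::finite"
  assumes full: "full_configuration a" and n: "CARD('n) \<le> CARD('m)"
  defines "b \<equiv> \<lambda>i. rat_vec (a i)" and "J \<equiv> first_indices CARD('n)"
  shows "inj_on b J" "vec.independent (b ` J)"
proof -
  have dim: "vec.dim (pos_cone J b) = CARD('n)"
    using full unfolding full_configuration_def Let_def b_def J_def by metis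
  have J: "card J = CARD('n)" unfolding J_def by (rule card_first_indices[OF n])
  have "pos_cone J b \<subseteq> vec.span (b ` J)"
    by (auto simp: pos_cone_def intro: vec.span_sum vec.span_scale vec.span_base)
  then have le: "CARD('n) \<le> vec.dim (b ` J)"
    using dim by (metis vec.dim_span vec.dim_subset)
  have "vec.dim (b ` J) \<le> card (b ` J)" by (intro vec.dim_le_card vec.span_superset) simp
  then have card: "card (b ` J) = card J" using le J card_image_le[of J b] by simp
  then show "inj_on b J" by (intro eq_card_imp_inj_on) simp_all
  show "vec.independent (b ` J)"
    using le card J by (intro vec.card_le_dim_spanning[of _ "b ` J"] vec.span_superset) auto
qed

text \<open>If the coefficient at \<open>k\<close> were 0, the functional dual to \<open>b k\<close>
  would cut out a face that contains \<open>b i\<close> but not \<open>b k\<close>, hence is smaller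
  than the cone.\<close>

lemma full_configuration_positive:
  fixes a :: "'m::{finite, linorder} \<Rightarrow> int ^ 'n::finite"
  assumes full: "full_configuration a" and n: "CARD('n) \<le> CARD('m)"
  defines "b \<equiv> \<lambda>i. rat_vec (a i)" and "J \<equiv> first_indices CARD('n)"
  assumes i: "i \<notin> J"
  shows "\<exists>c. b i = (\<Sum>j\<in>J. c j *s b j) \<and> (\<forall>j\<in>J. 0 < c j)"
proof -
  have inj: "inj_on b J" and ind: "vec.independent (b ` J)"
    using full_configuration_independent[OF full n] by (simp_all add: b_def J_def)
  let ?\<sigma> = "pos_cone UNIV b"
  have \<sigma>: "?\<sigma> = pos_cone J b" and face: "minimal_face ?\<sigma> (b i) = ?\<sigma>"
    using full i unfolding full_configuration_def Let_def b_def J_def by metis+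
  have b_mem: "b l \<in> ?\<sigma>" for l
  proof -
    have "b l = (\<Sum>j\<in>UNIV. (if j = l then 1 else 0) *s b j)"
      by (simp add: if_distrib[of "\<lambda>c. c *s _"] cong: if_cong)
    then show ?thesis unfolding pos_cone_def by (auto intro!: exI[of _ "\<lambda>j. if j = l then 1 else 0"])
  qed
  obtain c where c: "b i = (\<Sum>j\<in>J. c j *s b j)" "\<forall>j\<in>J. 0 \<le> c j"
    using b_mem[of i, unfolded \<sigma>] by (auto simp: pos_cone_def)
  have dot_sum: "rat_dot l (\<Sum>j\<in>J. d j *s b j) = (\<Sum>j\<in>J. d j * rat_dot l (b j))" for l d
    by (simp add: rat_dot_def sum_distrib_left sum.swap[of _ J] ac_simps)
  have "c k \<noteq> 0" if k: "k \<in> J" for k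
  proof
    assume ck: "c k = 0"
    obtain l where l: "\<forall>x\<in>b ` J. rat_dot l x = of_bool (x = b k)"
      using rat_linear_functional[OF ind, of "\<lambda>x. of_bool (x = b k)"] by blast
    have lb: "rat_dot l (b j) = of_bool (j = k)" if "j \<in> J" for j
      using l that k inj by (auto simp: inj_on_def)
    have coord: "rat_dot l (\<Sum>j\<in>J. d j *s b j) = d k" for d
    proof -
      have "(\<Sum>j\<in>J. d j * rat_dot l (b j)) = (\<Sum>j\<in>{k}. d j)"
        using k lb by (intro sum.mono_neutral_cong_right) auto
      then show ?thesis by (simp add: dot_sum)
    qed
    have "\<forall>x\<in>?\<sigma>. 0 \<le> rat_dot l x"
      unfolding \<sigma> using k coord by (auto simp: pos_cone_def)
    then have "cone_face ?\<sigma> (?\<sigma> \<inter> {x. rat_dot l x = 0})" unfolding cone_face_def by blast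
    moreover have "b i \<in> ?\<sigma> \<inter> {x. rat_dot l x = 0}" using b_mem[of i] coord[of c] c(1) ck by auto
    ultimately have "minimal_face ?\<sigma> (b i) \<subseteq> ?\<sigma> \<inter> {x. rat_dot l x = 0}"
      unfolding minimal_face_def by blast
    then have "rat_dot l (b k) = 0" using face b_mem[of k] by blast
    then show False using lb[OF k] by simp
  qed
  then show ?thesis using c by (metis order_le_less)
qed

lemma rat_vec_sum: "rat_vec (\<Sum>i\<in>A. c i *s f i) = (\<Sum>i\<in>A. of_int (c i) *s rat_vec (f i))"
  by (simp add: rat_vec_def vec_eq_iff)

lemma rat_vec_eq_0_iff: "rat_vec v = 0 \<longleftrightarrow> v = 0"
  by (simp add: rat_vec_def vec_eq_iff)

text \<open>The saturation consists of the integral relations of the configuration. Independence at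
  \<open>J\<close> gives \<open>independent\<close>; a positive combination with denominators
  cleared gives a relation with the signs of \<open>w s\<close>, and some multiple of it lies in
  \<open>L\<close>.\<close>

lemma full_lattice_of_configuration:
  fixes L :: "(int ^ 'm::{finite, linorder}) set"
    and \<psi> :: "(int ^ 'm::{finite, linorder}) set \<Rightarrow> int ^ 'n::finite"
  assumes L: "is_lattice L" and n: "CARD('n) \<le> CARD('m)"
    and \<psi>: "\<psi> \<in> iso (additive_group Mod saturation L) additive_group"
    and full: "full_configuration (associated_configuration L \<psi>)"
  shows "\<exists>N w. full_lattice L (first_indices CARD('n)) N w"
proof -
  define a where "a = associated_configuration L \<psi>"
  define b where "b = (\<lambda>i. rat_vec (a i))"
  define J where "J = (first_indices CARD('n) :: 'm set)"
  have rel: "v \<in> saturation L \<longleftrightarrow> (\<Sum>i\<in>UNIV. of_int (v $ i) *s b i) = 0" for v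
    using configuration_relation[OF lattice_saturation[OF L] \<psi>, of v]
    by (simp add: a_def b_def associated_configuration_def flip: rat_vec_sum rat_vec_eq_0_iff)
  have inj: "inj_on b J" and ind: "vec.independent (b ` J)"
    using full_configuration_independent[OF full n]
    by (simp_all add: a_def b_def J_def)
  have independent: "v = 0" if v: "v \<in> L" "\<And>i. i \<notin> J \<Longrightarrow> v $ i = 0" for v
  proof -
    have "v \<in> saturation L" using v(1) by (auto simp: saturation_def intro!: exI[of _ 1])
    moreover have "(\<Sum>i\<in>UNIV. of_int (v $ i) *s b i) = (\<Sum>j\<in>J. of_int (v $ j) *s b j)"
      using v(2) by (intro sum.mono_neutral_right) auto
    moreover have "(\<Sum>j\<in>J. of_int (v $ j) *s b j) = (\<Sum>x\<in>b ` J. of_int (v $ the_inv_into J b x) *s x)"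
      using inj by (simp add: sum.reindex the_inv_into_f_f)
    ultimately have "(\<Sum>x\<in>b ` J. of_int (v $ the_inv_into J b x) *s x) = 0" using rel by simp
    then have "of_int (v $ the_inv_into J b x) = (0 :: rat)" if "x \<in> b ` J" for x
      using vec.independentD[OF ind, of "b ` J" "\<lambda>x. of_int (v $ the_inv_into J b x)" x] that by simp
    then have "v $ j = 0" if "j \<in> J" for j using that inj by (force simp: the_inv_into_f_f)
    then show ?thesis using v(2) by (auto simp: vec_eq_iff)
  qed
  have "\<exists>w\<in>L. 0 < w $ s \<and> (\<forall>j\<in>J. w $ j < 0) \<and> (\<forall>i. i \<notin> J \<longrightarrow> i \<noteq> s \<longrightarrow> w $ i = 0)"
    if s: "s \<notin> J" for s
  proof -
    obtain c where c: "b s = (\<Sum>j\<in>J. c j *s b j)" "\<forall>j\<in>J. 0 < c j"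
      using full_configuration_positive[OF full n] s unfolding a_def b_def J_def by blast
    obtain d z where d: "0 < d" and z: "\<forall>j\<in>J. of_int d * c j = of_int (z j)"
      using rat_common_denominator[of J c] by auto
    have z_pos: "0 < z j" if "j \<in> J" for j
    proof -
      have "(0 :: rat) < of_int d * c j" using d c(2) that by simp
      then show ?thesis using z that by simp
    qed
    define v :: "int ^ 'm::{finite, linorder}" where "v = (\<chi> i. if i = s then d else if i \<in> J then - z i else 0)"
    have "(\<Sum>i\<in>UNIV. of_int (v $ i) *s b i) = (\<Sum>i\<in>insert s J. of_int (v $ i) *s b i)"
      by (intro sum.mono_neutral_right) (auto simp: v_def)
    also have "\<dots> = of_int d *s b s + (\<Sum>j\<in>J. of_int (- z j) *s b j)"
      using s by (auto simp: v_def intro!: sum.cong)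
    also have "(\<Sum>j\<in>J. of_int (- z j) *s b j) = - (\<Sum>j\<in>J. (of_int d * c j) *s b j)"
      using z by (simp add: sum_negf)
    also have "\<dots> = - (of_int d *s b s)"
      by (simp add: c(1) vec.scale_sum_right)
    finally have "v \<in> saturation L" using rel by simp
    then obtain e where e: "e \<noteq> 0" "e *s v \<in> L" by (auto simp: saturation_def)
    \<comment> \<open>The absolute value keeps the signs of \<open>v\<close>.\<close>
    have "\<bar>e\<bar> *s v = (if 0 < e then e *s v else - (e *s v))" using e(1) by (auto simp: vec_eq_iff)
    then have "\<bar>e\<bar> *s v \<in> L" using e(2) lattice_uminus[OF L] by auto
    then show ?thesis
      using e(1) d z_pos s by (intro bexI[of _ "\<bar>e\<bar> *s v"]) (auto simp: v_def)
  qed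
  then obtain w where w: "\<And>s. s \<notin> J \<Longrightarrow> w s \<in> L" "\<And>s. s \<notin> J \<Longrightarrow> 0 < w s $ s"
    "\<And>s j. s \<notin> J \<Longrightarrow> j \<in> J \<Longrightarrow> w s $ j < 0"
    "\<And>s i. s \<notin> J \<Longrightarrow> i \<notin> J \<Longrightarrow> i \<noteq> s \<Longrightarrow> w s $ i = 0"
    by metis
  \<comment> \<open>A common multiple of the diagonal entries, to which all vectors are
    rescaled.\<close>
  define N where "N = (\<Prod>s\<in>-J. w s $ s)"
  have N: "0 < N" unfolding N_def using w(2) by (intro prod_pos) auto
  have dvd: "w s $ s dvd N" if "s \<notin> J" for s unfolding N_def using that by (intro dvd_prodI) auto
  have quot: "0 < N div w s $ s" if "s \<notin> J" for s
    using dvd[OF that] w(2)[OF that] N by (auto elim!: dvdE simp: zero_less_mult_iff)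
  have "full_lattice L J N (\<lambda>s. (N div w s $ s) *s w s)"
  proof
    show "is_lattice L" "0 < N" by fact+
    show "v = 0" if "v \<in> L" "\<And>i. i \<notin> J \<Longrightarrow> v $ i = 0" for v using independent that by blast
  next
    fix s assume s: "s \<notin> J"
    show "(N div w s $ s) *s w s \<in> L" using s w(1) by (intro lattice_scale L)
    show "((N div w s $ s) *s w s) $ s = N" using dvd[OF s] by simp
    show "((N div w s $ s) *s w s) $ i = 0" if "i \<notin> J" "i \<noteq> s" for i using w(4)[OF s that] by simp
    show "((N div w s $ s) *s w s) $ j < 0" if "j \<in> J" for j
      using w(3)[OF s that] quot[OF s] by (simp add: mult_pos_neg)
  qed
  then show ?thesis unfolding J_def by blast
qed

theorem theorem4p4:
  fixes L :: "(int ^ 'm::{finite, linorder}) set"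
    and \<rho> :: "int ^ 'm::{finite, linorder} \<Rightarrow> 'k::field"
    and \<psi> :: "(int ^ 'm::{finite, linorder}) set \<Rightarrow> int ^ 'n::finite"
  assumes "partial_character L \<rho>"
    and "L \<noteq> {0}"
    and "positive_lattice L"
    and "CARD('n) = CARD('m) - lattice_rank L"
    and "\<psi> \<in> iso (additive_group Mod saturation L) additive_group"
    and "full_configuration (associated_configuration L \<psi>)"
  shows "(CHAR('k) = 0 \<longrightarrow>
            set_theoretic_ci (lattice_ideal L \<rho>) \<or> almost_set_theoretic_ci (lattice_ideal L \<rho>))
       \<and> (CHAR('k) > 0 \<longrightarrow> set_theoretic_ci (lattice_ideal L \<rho>))"
proof -
  note \<rho> = assms(1)
  let ?I = "lattice_ideal L \<rho>"
  define J where "J = (first_indices CARD('n) :: 'm set)"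
  have n: "CARD('n) \<le> CARD('m)" using assms(4) by simp
  have J: "card J = CARD('n)" unfolding J_def by (rule card_first_indices[OF n])
  \<comment> \<open>Positivity shows that the truncated subtraction in the hypothesis is exact, so
    the number of indices outside of \<open>J\<close> is the rank.\<close>
  have "0 < CARD('n)" by simp
  then have "card (-J) = lattice_rank L"
    using assms(4) J by (simp add: Compl_eq_Diff_UNIV card_Diff_subset)
  then have height_ge: "enat (card (-J)) \<le> ideal_height ?I" using lattice_rank_le_height[OF \<rho>] by simp
  obtain N w where "full_lattice L J N w"
    using full_lattice_of_configuration[OF partial_character_lattice[OF \<rho>] n assms(5,6)]
    unfolding J_def by blast
  then interpret full_lattice L J N w .
  have "J \<noteq> {}" using J by auto
  then have ara_ge: "enat (card (-J)) \<le> ara ?I" by (rule le_ara_lattice_ideal[OF \<rho>])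
  have "supported_in J L = {0}"
    using independent lattice_zero[OF lattice_L] by (auto simp: supported_in_def)
  then have "ideal_height ?I \<le> enat (card (-J))" by (rule ideal_height_lattice_ideal_le[OF \<rho>])
  then have height: "ideal_height ?I = enat (card (-J))" using height_ge by (rule antisym)
  have "almost_set_theoretic_ci ?I"
    using ara_lattice_ideal_le_Suc[OF \<rho>]
    by (simp add: almost_set_theoretic_ci_def height one_enat_def)
  moreover have "set_theoretic_ci ?I" if "0 < CHAR('k)"
    using ara_lattice_ideal_le[OF \<rho> that] ara_ge by (simp add: set_theoretic_ci_def height)
  ultimately show ?thesis by blast
qed

end
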